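(* Let $I_1,\dots,I_M$ be a uniform partition of $D=[0,1]^d$ with $\mathrm{Vol}(I_i)=\frac1M$, and let $\mathcal{F}\subseteq\mathbb{R}^{M\times M}$ be a subset of positive semi-definite matrices. For every $\Sigma\in\mathcal{F}$ define $$k_\Sigma(x,y)=\sum_{i,j=1}^M\Sigma_{ij}\mathbf{1}\{x\in I_i\}\mathbf{1}\{y\in I_j\},\qquad(\mathcal{C}_\Sigma\psi)(\cdot)=\int_Dk_\Sigma(\cdot,y)\psi(y)\,dy.$$ Then: (a) $\mathcal{C}_\Sigma:L^2(D)\to L^2(D)$ is positive semi-definite and trace-class. (b) $\|\mathcal{C}_\Sigma\|=\frac1M\|\Sigma\|$. (c) Let $\mathcal{F}^*=\{\mathcal{C}_\Sigma:\Sigma\in\mathcal{F}\}$, let $u_1,\dots,u_N$ be i.i.d. $\mathrm{GP}(0,\mathcal{C})$, and let $X_1,\dots,X_N$ be i.i.d. $\mathcal{N}(0,\Sigma)$. Then $$\inf_{\widehat{\mathcal{C}}}\sup_{\mathcal{C}\in\mathcal{F}^*}\mathbb{E}\|\widehat{\mathcal{C}}-\mathcal{C}\|\ge\frac1M\inf_{\widehat\Sigma}\sup_{\Sigma\in\mathcal{F}}\mathbb{E}\|\widehat\Sigma-\Sigma\|$$ and $$\inf_{\widehat{\mathcal{C}}}\sup_{\mathcal{C}\in\mathcal{F}^*}\frac{\mathbb{E}\|\widehat{\mathcal{C}}-\mathcal{C}\|}{\|\mathcal{C}\|}\ge\inf_{\widehat\Sigma}\sup_{\Sigma\in\mathcal{F}}\frac{\mathbb{E}\|\widehat\Sigma-\Sigma\|}{\|\Sigma\|},$$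 where $\inf_{\widehat{\mathcal{C}}}$ is taken over kernel integral operators $\widehat{\mathcal{C}}$ whose kernel $\hat k$ is a measurable function of $\{u_n(\cdot)\}_{n=1}^N$ and $\inf_{\widehat\Sigma}$ is taken over measurable functions $\widehat\Sigma$ of $\{X_n\}_{n=1}^N$.
   Context: $\|\cdot\|$ denotes the operator norm (on $L^2(D)$ for operators, the spectral norm for matrices). $\mathrm{Vol}$ is Lebesgue measure. $\mathrm{GP}(0,\mathcal{C})$ denotes the centered Gaussian process on $D$ with covariance operator $\mathcal{C}$; for $\mathcal{C}=\mathcal{C}_\Sigma$ it has covariance function $k_\Sigma$. Each expectation is taken under the data distribution determined by the parameter ($\mathcal{C}$ or $\Sigma$) over which the supremum is taken. In the relative-error inequality, parameters are understood to be nonzero so the ratios make sense. *)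

theory Defs
  imports "HOL-Probability.Probability"
begin

section \<open>The real Hilbert space of square integrable functions on the unit cube\<close>

abbreviation unit_cube :: "(real^'d) set" where
  "unit_cube \<equiv> cbox 0 1"

definition cube_measure :: "(real^'d) measure" where
  "cube_measure = restrict_space lborel unit_cube"

definition sq_int :: "(real^'d \<Rightarrow> real) set" where
  "sq_int = {f \<in> borel_measurable cube_measure. integrable cube_measure (\<lambda>x. (f x)\<^sup>2)}"

lemma sq_int_measurable: "f \<in> sq_int \<Longrightarrow> f \<in> borel_measurable cube_measure"
  by (simp add: sq_int_def)

lemma sq_int_zero: "(\<lambda>_. 0) \<in> sq_int"
  by (simp add: sq_int_def)

lemma sq_int_mult_integrable:
  assumes "f \<in> sq_int" "g \<in> sq_int"
  shows "integrable cube_measure (\<lambda>x. f x * g x)"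
proof (rule Bochner_Integration.integrable_bound)
  show "integrable cube_measure (\<lambda>x. (f x)\<^sup>2 + (g x)\<^sup>2)"
    using assms by (simp add: sq_int_def)
  show "(\<lambda>x. f x * g x) \<in> borel_measurable cube_measure"
    using assms[THEN sq_int_measurable] by measurable
  have "\<bar>a * b\<bar> \<le> a\<^sup>2 + b\<^sup>2" for a b :: real
  proof -
    have "2 * (\<bar>a\<bar> * \<bar>b\<bar>) \<le> a\<^sup>2 + b\<^sup>2"
      using sum_squares_bound[of "\<bar>a\<bar>" "\<bar>b\<bar>"] by (simp add: mult.assoc)
    moreover have "0 \<le> \<bar>a\<bar> * \<bar>b\<bar>" by simp
    ultimately show ?thesis unfolding abs_mult by linarith
  qed
  then show "AE x in cube_measure. norm (f x * g x) \<le> norm ((f x)\<^sup>2 + (g x)\<^sup>2)"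
    by simp
qed

lemma sq_int_add:
  assumes "f \<in> sq_int" "g \<in> sq_int"
  shows "(\<lambda>x. f x + g x) \<in> sq_int"
proof -
  have "integrable cube_measure (\<lambda>x. (f x)\<^sup>2 + (g x)\<^sup>2 + 2 * (f x * g x))"
    using assms sq_int_mult_integrable[OF assms] by (simp add: sq_int_def)
  moreover have "(\<lambda>x. f x + g x) \<in> borel_measurable cube_measure"
    using assms[THEN sq_int_measurable] by measurable
  ultimately show ?thesis
    by (simp add: sq_int_def power2_sum mult.assoc)
qed

lemma sq_int_scale:
  assumes "f \<in> sq_int"
  shows "(\<lambda>x. r * f x) \<in> sq_int"
proof -
  have "(\<lambda>x. r * f x) \<in> borel_measurable cube_measure"
    using assms[THEN sq_int_measurable] by measurable
  then show ?thesis
    using assms by (simp add: sq_int_def power_mult_distrib)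
qed

quotient_type 'd L2 = "real^'d \<Rightarrow> real" / partial:
  "\<lambda>f g. f \<in> sq_int \<and> g \<in> sq_int \<and> (AE x in cube_measure. f x = g x)"
proof (rule part_equivpI)
  show "\<exists>f. f \<in> sq_int \<and> f \<in> sq_int \<and> (AE x in cube_measure. f x = (f x :: real))"
    using sq_int_zero by auto
  show "symp (\<lambda>f g. f \<in> sq_int \<and> g \<in> sq_int \<and> (AE x in cube_measure. f x = (g x :: real)))"
    by (rule sympI) (auto elim: eventually_mono)
  show "transp (\<lambda>f g. f \<in> sq_int \<and> g \<in> sq_int \<and> (AE x in cube_measure. f x = (g x :: real)))"
    by (rule transpI) (auto elim: eventually_elim2)
qed

instantiation L2 :: (finite) real_vector
begin

lift_definition zero_L2 :: "'a L2" is "\<lambda>_. 0"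
  by (simp add: sq_int_zero)

lift_definition plus_L2 :: "'a L2 \<Rightarrow> 'a L2 \<Rightarrow> 'a L2" is "\<lambda>f g x. f x + g x"
  by (auto simp: sq_int_add elim: eventually_elim2)

lift_definition scaleR_L2 :: "real \<Rightarrow> 'a L2 \<Rightarrow> 'a L2" is "\<lambda>r f x. r * f x"
  by (auto simp: sq_int_scale elim: eventually_mono)

lift_definition uminus_L2 :: "'a L2 \<Rightarrow> 'a L2" is "\<lambda>f x. - f x"
  using sq_int_scale[where r = "- 1"] by (auto elim: eventually_mono)

lift_definition minus_L2 :: "'a L2 \<Rightarrow> 'a L2 \<Rightarrow> 'a L2" is "\<lambda>f g x. f x - g x"
  using sq_int_add[OF _ sq_int_scale[where r = "- 1"]] by (auto elim: eventually_elim2)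

instance
proof
  fix f g h :: "'a L2" and r s :: real
  show "f + g + h = f + (g + h)"
    by transfer (auto intro!: sq_int_add simp: algebra_simps)
  show "f + g = g + f"
    by transfer (auto intro!: sq_int_add simp: algebra_simps)
  show "0 + f = f"
    by transfer auto
  show "- f + f = 0"
    by transfer (auto intro!: sq_int_zero)
  show "f - g = f + - g"
    by transfer (use sq_int_add[OF _ sq_int_scale[where r = "- 1"]] in auto)
  show "r *\<^sub>R (f + g) = r *\<^sub>R f + r *\<^sub>R g"
    by transfer (auto intro!: sq_int_add sq_int_scale simp: algebra_simps)
  show "(r + s) *\<^sub>R f = r *\<^sub>R f + s *\<^sub>R f"
    by transfer (auto intro!: sq_int_add sq_int_scale simp: distrib_right)
  show "r *\<^sub>R s *\<^sub>R f = (r * s) *\<^sub>R f"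
    by transfer (auto intro!: sq_int_scale simp: mult.assoc)
  show "1 *\<^sub>R f = f"
    by transfer auto
qed

end

instantiation L2 :: (finite) real_inner
begin

lift_definition inner_L2 :: "'a L2 \<Rightarrow> 'a L2 \<Rightarrow> real" is
  "\<lambda>f g. \<integral>x. f x * g x \<partial>cube_measure"
proof -
  fix f f' g g' :: "real^'a \<Rightarrow> real"
  assume "f \<in> sq_int \<and> f' \<in> sq_int \<and> (AE x in cube_measure. f x = f' x)"
    and "g \<in> sq_int \<and> g' \<in> sq_int \<and> (AE x in cube_measure. g x = g' x)"
  then have "AE x in cube_measure. f x * g x = f' x * g' x"
    and [measurable]: "f \<in> borel_measurable cube_measure" "g \<in> borel_measurable cube_measure"
      "f' \<in> borel_measurable cube_measure" "g' \<in> borel_measurable cube_measure"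
    by (auto simp: sq_int_measurable elim: eventually_elim2)
  then show "(\<integral>x. f x * g x \<partial>cube_measure) = (\<integral>x. f' x * g' x \<partial>cube_measure)"
    by (intro integral_cong_AE) measurable
qed

definition norm_L2 :: "'a L2 \<Rightarrow> real" where
  "norm_L2 f = sqrt (inner f f)"

definition dist_L2 :: "'a L2 \<Rightarrow> 'a L2 \<Rightarrow> real" where
  "dist_L2 f g = norm (f - g)"

definition sgn_L2 :: "'a L2 \<Rightarrow> 'a L2" where
  "sgn_L2 f = f /\<^sub>R norm f"

definition uniformity_L2 :: "('a L2 \<times> 'a L2) filter" where
  "uniformity_L2 = (INF e\<in>{0<..}. principal {(x, y). dist x y < e})"

definition open_L2 :: "'a L2 set \<Rightarrow> bool" where
  "open_L2 U \<longleftrightarrow> (\<forall>x\<in>U. eventually (\<lambda>(x', y). x' = x \<longrightarrow> y \<in> U) uniformity)"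

instance
proof
  fix f g h :: "'a L2" and r :: real
  show "dist f g = norm (f - g)"
    by (rule dist_L2_def)
  show "sgn f = f /\<^sub>R norm f"
    by (rule sgn_L2_def)
  show "uniformity = (INF e\<in>{0<..}. principal {(x :: 'a L2, y). dist x y < e})"
    by (rule uniformity_L2_def)
  show "open U \<longleftrightarrow> (\<forall>x\<in>U. eventually (\<lambda>(x', y). x' = x \<longrightarrow> y \<in> U) uniformity)" for U :: "'a L2 set"
    by (rule open_L2_def)
  show "inner f g = inner g f"
    by transfer (simp add: mult.commute)
  show "inner (f + g) h = inner f h + inner g h"
    by transfer (simp add: distrib_right sq_int_mult_integrable)
  show "inner (r *\<^sub>R f) g = r * inner f g"
    by transfer (simp add: mult.assoc)
  show "0 \<le> inner f f"
    by transfer simp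
  show "inner f f = 0 \<longleftrightarrow> f = 0"
  proof transfer
    fix f :: "real^'a \<Rightarrow> real"
    assume "f \<in> sq_int \<and> f \<in> sq_int \<and> (AE x in cube_measure. f x = f x)"
    then have f: "f \<in> sq_int" by simp
    have "(\<integral>x. f x * f x \<partial>cube_measure) = 0 \<longleftrightarrow> (AE x in cube_measure. f x * f x = 0)"
      by (rule integral_nonneg_eq_0_iff_AE) (auto simp: f sq_int_mult_integrable)
    then show "(\<integral>x. f x * f x \<partial>cube_measure) = 0 \<longleftrightarrow>
        f \<in> sq_int \<and> (\<lambda>_. 0) \<in> sq_int \<and> (AE x in cube_measure. f x = 0)"
      using f by (simp add: sq_int_zero)
  qed
  show "norm f = sqrt (inner f f)"
    by (rule norm_L2_def)
qed

end


section \<open>Positive semi-definite and trace-class operators\<close>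

definition psd_operator :: "('h::real_inner \<Rightarrow> 'h) \<Rightarrow> bool" where
  "psd_operator A \<longleftrightarrow>
     bounded_linear A \<and> (\<forall>x y. A x \<bullet> y = x \<bullet> A y) \<and> (\<forall>x. 0 \<le> x \<bullet> A x)"

definition psd_matrix :: "real^'m^'m \<Rightarrow> bool" where
  "psd_matrix S \<longleftrightarrow> transpose S = S \<and> (\<forall>v. 0 \<le> v \<bullet> (S *v v))"

text \<open>In a Hilbert space a maximal orthonormal set is the same as an orthonormal basis.\<close>

definition orthonormal_basis :: "'h::real_inner set \<Rightarrow> bool" where
  "orthonormal_basis E \<longleftrightarrow>
     pairwise orthogonal E \<and> (\<forall>e\<in>E. norm e = 1) \<and> (\<forall>x. (\<forall>e\<in>E. x \<bullet> e = 0) \<longrightarrow> x = 0)"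

text \<open>The operator \<open>A\<close> below is the absolute value of \<open>T\<close>, i.e. the positive square root of
  \<open>T* T\<close>; the sum of its diagonal coefficients does not depend on the choice of the
  orthonormal basis \<open>E\<close>.\<close>

definition trace_class :: "('h::real_inner \<Rightarrow> 'h) \<Rightarrow> bool" where
  "trace_class T \<longleftrightarrow> bounded_linear T \<and>
     (\<exists>A. psd_operator A \<and> (\<forall>x. A (A x) = adjoint T (T x)) \<and>
        (\<exists>E. orthonormal_basis E \<and> (\<lambda>e. e \<bullet> A e) summable_on E))"


section \<open>Kernel integral operators\<close>

text \<open>\<open>rep_L2 \<psi>\<close> is some representative of the class \<open>\<psi>\<close>. The definition is meaningful only for
  kernels satisfying \<open>L2_kernel\<close>.\<close>

definition integral_operator :: "(real^'d \<Rightarrow> real^'d \<Rightarrow> real) \<Rightarrow> 'd L2 \<Rightarrow> 'd L2" where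
  "integral_operator k \<psi> = abs_L2 (\<lambda>x. \<integral>y. k x y * rep_L2 \<psi> y \<partial>cube_measure)"

text \<open>The kernel \<open>k\<close> defines a bounded integral operator on \<open>L\<^sup>2\<close>. The integrability clause is needed
  because the Bochner integral of a non-integrable function is \<open>0\<close> by convention.\<close>

definition L2_kernel :: "(real^'d \<Rightarrow> real^'d \<Rightarrow> real) \<Rightarrow> bool" where
  "L2_kernel k \<longleftrightarrow>
     (\<lambda>(x, y). k x y) \<in> borel_measurable (cube_measure \<Otimes>\<^sub>M cube_measure) \<and>
     (\<forall>f\<in>sq_int. (AE x in cube_measure. integrable cube_measure (\<lambda>y. k x y * f y)) \<and>
        (\<lambda>x. \<integral>y. k x y * f y \<partial>cube_measure) \<in> sq_int) \<and>
     bounded_linear (integral_operator k)"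

definition uniform_partition :: "('m::finite \<Rightarrow> (real^'d) set) \<Rightarrow> bool" where
  "uniform_partition I \<longleftrightarrow>
     (\<forall>i. I i \<in> sets borel) \<and> disjoint_family I \<and> (\<Union>i. I i) = unit_cube \<and>
     (\<forall>i. measure lborel (I i) = 1 / real CARD('m))"

definition block_kernel ::
  "('m::finite \<Rightarrow> (real^'d) set) \<Rightarrow> real^'m^'m \<Rightarrow> real^'d \<Rightarrow> real^'d \<Rightarrow> real" where
  "block_kernel I S x y =
     (\<Sum>i\<in>UNIV. \<Sum>j\<in>UNIV. S $ i $ j * indicator (I i) x * indicator (I j) y)"

definition block_operator ::
  "('m::finite \<Rightarrow> (real^'d) set) \<Rightarrow> real^'m^'m \<Rightarrow> 'd L2 \<Rightarrow> 'd L2" where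
  "block_operator I S = integral_operator (block_kernel I S)"


section \<open>Gaussian data\<close>

text \<open>The normal law \<open>N(0, v)\<close> on the reals for \<open>v \<ge> 0\<close>, including the degenerate case \<open>v = 0\<close>.\<close>

definition centered_normal :: "real \<Rightarrow> real measure" where
  "centered_normal v = distr std_normal_distribution borel (\<lambda>z. sqrt v * z)"

definition gaussian_vector :: "'w measure \<Rightarrow> real^'m^'m \<Rightarrow> ('w \<Rightarrow> real^'m) \<Rightarrow> bool" where
  "gaussian_vector P S X \<longleftrightarrow> X \<in> borel_measurable P \<and>
     (\<forall>a. distr P borel (\<lambda>w. a \<bullet> X w) = centered_normal (a \<bullet> (S *v a)))"

text \<open>A centered Gaussian process on the cube with covariance function \<open>k\<close>. As the covariance is
  to act as an operator on \<open>L\<^sup>2\<close>, the process is jointly measurable with paths in \<open>L\<^sup>2\<close>.\<close>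

definition gaussian_process ::
  "'w measure \<Rightarrow> (real^'d \<Rightarrow> real^'d \<Rightarrow> real) \<Rightarrow> ('w \<Rightarrow> real^'d \<Rightarrow> real) \<Rightarrow> bool" where
  "gaussian_process P k u \<longleftrightarrow>
     (\<lambda>(w, x). u w x) \<in> borel_measurable (P \<Otimes>\<^sub>M cube_measure) \<and>
     (\<forall>w\<in>space P. u w \<in> sq_int) \<and>
     (\<forall>T c. finite T \<and> T \<subseteq> unit_cube \<longrightarrow>
        distr P borel (\<lambda>w. \<Sum>x\<in>T. c x * u w x) =
        centered_normal (\<Sum>x\<in>T. \<Sum>y\<in>T. c x * c y * k x y))"

text \<open>The space of sample paths, with the sigma-algebra generated by all point evaluations and all
  inner products with square integrable functions. The evaluations alone would not suffice: the
  cylinder sigma-algebra makes no integral of a path over a set of positive measure measurable.\<close>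

definition path_space :: "(real^'d \<Rightarrow> real) measure" where
  "path_space = sigma sq_int
     ({{u \<in> sq_int. u x \<in> B} | x B. x \<in> unit_cube \<and> B \<in> sets borel} \<union>
      {{u \<in> sq_int. (\<integral>x. u x * f x \<partial>cube_measure) \<in> B} | f B. f \<in> sq_int \<and> B \<in> sets borel})"

definition iid_gaussian_processes ::
  "'w measure \<Rightarrow> nat \<Rightarrow> (real^'d \<Rightarrow> real^'d \<Rightarrow> real) \<Rightarrow> (nat \<Rightarrow> 'w \<Rightarrow> real^'d \<Rightarrow> real) \<Rightarrow> bool" where
  "iid_gaussian_processes P N k u \<longleftrightarrow> prob_space P \<and>
     (\<forall>n<N. gaussian_process P k (u n)) \<and>
     prob_space.indep_vars P (\<lambda>_. path_space) u {..<N}"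

definition iid_gaussian_vectors ::
  "'w measure \<Rightarrow> nat \<Rightarrow> real^'m^'m \<Rightarrow> (nat \<Rightarrow> 'w \<Rightarrow> real^'m) \<Rightarrow> bool" where
  "iid_gaussian_vectors P N S X \<longleftrightarrow> prob_space P \<and>
     (\<forall>n<N. gaussian_vector P S (X n)) \<and>
     prob_space.indep_vars P (\<lambda>_. borel) X {..<N}"


section \<open>Estimators and risks\<close>

text \<open>Operator-valued estimators: integral operators on \<open>L\<^sup>2\<close> whose kernel is a measurable function
  of the \<open>N\<close> observed paths (and of the two spatial arguments).\<close>

definition operator_estimators :: "nat \<Rightarrow> ((nat \<Rightarrow> real^'d \<Rightarrow> real) \<Rightarrow> 'd L2 \<Rightarrow> 'd L2) set" where
  "operator_estimators N = {Chat. \<exists>khat.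
     (\<lambda>(u, x, y). khat u x y) \<in> borel_measurable
        ((\<Pi>\<^sub>M n\<in>{..<N}. path_space) \<Otimes>\<^sub>M (cube_measure \<Otimes>\<^sub>M cube_measure)) \<and>
     (\<forall>u\<in>space (\<Pi>\<^sub>M n\<in>{..<N}. path_space).
        L2_kernel (khat u) \<and> Chat u = integral_operator (khat u))}"

definition matrix_estimators :: "nat \<Rightarrow> ((nat \<Rightarrow> real^'m) \<Rightarrow> real^'m^'m) set" where
  "matrix_estimators N = borel_measurable (\<Pi>\<^sub>M n\<in>{..<N}. borel)"

text \<open>Expected operator-norm errors, possibly infinite.\<close>

definition operator_risk ::
  "'w measure \<Rightarrow> nat \<Rightarrow> (nat \<Rightarrow> 'w \<Rightarrow> real^'d \<Rightarrow> real) \<Rightarrow>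
   ((nat \<Rightarrow> real^'d \<Rightarrow> real) \<Rightarrow> 'd L2 \<Rightarrow> 'd L2) \<Rightarrow> ('d L2 \<Rightarrow> 'd L2) \<Rightarrow> ennreal" where
  "operator_risk P N u Chat C =
     (\<integral>\<^sup>+w. ennreal (onorm (\<lambda>\<psi>. Chat (\<lambda>n\<in>{..<N}. u n w) \<psi> - C \<psi>)) \<partial>P)"

definition matrix_risk ::
  "'w measure \<Rightarrow> nat \<Rightarrow> (nat \<Rightarrow> 'w \<Rightarrow> real^'m) \<Rightarrow>
   ((nat \<Rightarrow> real^'m) \<Rightarrow> real^'m^'m) \<Rightarrow> real^'m^'m \<Rightarrow> ennreal" where
  "matrix_risk P N X Shat S =
     (\<integral>\<^sup>+w. ennreal (onorm ((*v) (Shat (\<lambda>n\<in>{..<N}. X n w) - S))) \<partial>P)"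

end

theory Submission
  imports Defs
begin

text \<open>Up to scaling, \<open>v \<mapsto> \<Sum>i. v\<^sub>i 1{x \<in> I\<^sub>i}\<close> is an isometric embedding \<open>J\<close> of \<open>\<real>\<^sup>M\<close> into \<open>L\<^sup>2\<close>, with
  \<open>J\<^sup>* J = 1/M\<close> and block operator \<open>J \<Sigma> J\<^sup>*\<close>; this gives (a) and (b). For (c), compressing an
  operator estimator to \<open>M\<^sup>2 J\<^sup>* C J\<close>, applied to the paths \<open>J X\<^sub>n\<close>, gives a matrix estimator whose
  error is at most \<open>M\<close> times that of the operator estimator. The paths \<open>J X\<^sub>n\<close> have the same law as
  the given processes: the block covariance forces a process to be almost surely equal at any two
  points of a cell, so by Fubini its path is almost surely a step function almost everywhere, and
  the vector of its values has law \<open>N(0, \<Sigma>)\<close>, which the laws of its linear functionals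
  determine.\<close>

section \<open>Square integrable functions and orthonormal bases\<close>

lemma abs_L2_rep [simp]: "abs_L2 (rep_L2 \<psi>) = \<psi>"
  by (rule Quotient3_abs_rep[OF Quotient3_L2])

lemma rep_L2_sq_int [simp]: "rep_L2 \<psi> \<in> sq_int"
  using Quotient3_rel_rep[OF Quotient3_L2, of \<psi> \<psi>] by simp

lemma abs_L2_eq:
  assumes "f \<in> sq_int" "g \<in> sq_int" "AE x in cube_measure. f x = g x"
  shows "abs_L2 f = abs_L2 g"
  using Quotient3_rel[OF Quotient3_L2, of f g] assms by simp

lemma rep_abs_L2:
  assumes "f \<in> sq_int"
  shows "AE x in cube_measure. rep_L2 (abs_L2 f) x = f x"
  using rep_abs_rsp[OF Quotient3_L2, of f f] assms by (auto elim: eventually_mono)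

lemma inner_abs_L2:
  assumes "f \<in> sq_int" "g \<in> sq_int"
  shows "abs_L2 f \<bullet> abs_L2 g = (\<integral>x. f x * g x \<partial>cube_measure)"
  using assms by (simp add: inner_L2.abs_eq)

text \<open>\<open>integral_operator\<close> works with an unspecified representative of the class.
  For each fixed \<open>x\<close> in the cube, changing it on a null set leaves the integral over
  \<open>y\<close> unchanged, so any convenient representative may be inserted.\<close>

lemma integral_operator_abs:
  assumes k: "L2_kernel k" and f: "f \<in> sq_int"
  shows "integral_operator k (abs_L2 f) = abs_L2 (\<lambda>x. \<integral>y. k x y * f y \<partial>cube_measure)"
proof -
  have kf: "(\<lambda>x. \<integral>y. k x y * g y \<partial>cube_measure) \<in> sq_int" if "g \<in> sq_int" for g
    using k that by (simp add: L2_kernel_def)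
  have [measurable]: "(\<lambda>(x, y). k x y) \<in> borel_measurable (cube_measure \<Otimes>\<^sub>M cube_measure)"
    using k by (simp add: L2_kernel_def)
  have [measurable]: "f \<in> borel_measurable cube_measure"
    "rep_L2 (abs_L2 f) \<in> borel_measurable cube_measure"
    using f by (auto simp: sq_int_measurable)
  have "(\<integral>y. k x y * rep_L2 (abs_L2 f) y \<partial>cube_measure) = (\<integral>y. k x y * f y \<partial>cube_measure)"
    if [measurable]: "x \<in> space cube_measure" for x
    using rep_abs_L2[OF f] by (intro integral_cong_AE) (measurable, auto)
  then have "AE x in cube_measure.
      (\<integral>y. k x y * rep_L2 (abs_L2 f) y \<partial>cube_measure) = (\<integral>y. k x y * f y \<partial>cube_measure)"
    by (rule AE_I2)
  then show ?thesis
    unfolding integral_operator_def by (intro abs_L2_eq kf f) simp_all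
qed

lemma space_cube [simp]: "space cube_measure = unit_cube"
  by (simp add: cube_measure_def space_restrict_space)

lemma sets_cube: "sets cube_measure = sets (restrict_space borel unit_cube)"
  by (simp add: cube_measure_def sets_restrict_space)

lemma finite_cube: "finite_measure (cube_measure :: (real^'d) measure)"
  by (rule finite_measureI)
    (simp add: cube_measure_def space_restrict_space emeasure_restrict_space emeasure_lborel_cbox_eq)

interpretation cube: finite_measure cube_measure
  by (rule finite_cube)

text \<open>Since \<open>orthonormal_basis\<close> is phrased as maximality, Zorn's lemma for the
  orthonormal supersets of \<open>B\<close> produces one: a nonzero vector orthogonal to the maximal
  set could be normalized and added to it.\<close>

lemma orthonormal_basis_extension:
  fixes B :: "'h::real_inner set"
  assumes "pairwise orthogonal B" "\<forall>e\<in>B. norm e = 1"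
  obtains E where "B \<subseteq> E" "orthonormal_basis E"
proof -
  let ?O = "{E. B \<subseteq> E \<and> pairwise orthogonal E \<and> (\<forall>e\<in>E. norm e = 1)}"
  have "\<exists>E\<in>?O. \<forall>X\<in>?O. E \<subseteq> X \<longrightarrow> X = E"
  proof (rule subset_Zorn_nonempty)
    show "?O \<noteq> {}" using assms by blast
  next
    fix \<C> assume ne: "\<C> \<noteq> {}" and C: "subset.chain ?O \<C>"
    then have "\<C> \<subseteq> ?O" and "chain\<^sub>\<subseteq> \<C>"
      by (auto simp: subset_chain_def chain_subset_def)
    moreover from this have "pairwise orthogonal (\<Union>\<C>)"
      by (intro pairwise_chain_Union) auto
    moreover have "B \<subseteq> \<Union>\<C>" "\<forall>e\<in>\<Union>\<C>. norm e = 1"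
      using ne \<open>\<C> \<subseteq> ?O\<close> by blast+
    ultimately show "\<Union>\<C> \<in> ?O" by simp
  qed
  then obtain E where "E \<in> ?O" and max: "\<forall>X\<in>?O. E \<subseteq> X \<longrightarrow> X = E" ..
  then have E: "B \<subseteq> E" "pairwise orthogonal E" "\<forall>e\<in>E. norm e = 1"
    by simp_all
  have "x = 0" if x: "\<forall>e\<in>E. x \<bullet> e = 0" for x
  proof (rule ccontr)
    assume "x \<noteq> 0"
    define y where "y = sgn x"
    have y: "norm y = 1" "\<forall>e\<in>E. y \<bullet> e = 0"
      using x \<open>x \<noteq> 0\<close> by (auto simp: y_def norm_sgn sgn_div_norm)
    then have "insert y E \<in> ?O"
      using E by (auto simp: pairwise_insert orthogonal_def inner_commute)
    then have "y \<in> E" using max by blast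
    then show False using y by (auto simp: norm_eq_sqrt_inner)
  qed
  then show thesis
    using E that by (auto simp: orthonormal_basis_def)
qed


section \<open>Step functions and block operators\<close>

locale cube_partition =
  fixes I :: "'m::finite \<Rightarrow> (real^'d) set"
  assumes partition: "uniform_partition I"
begin

lemma cell_borel [measurable]: "I i \<in> sets borel"
  using partition by (simp add: uniform_partition_def)

lemma cell_subset: "I i \<subseteq> unit_cube"
  using partition by (auto simp: uniform_partition_def)

lemma cell_disjoint: "x \<in> I i \<Longrightarrow> x \<in> I j \<Longrightarrow> i = j"
  using partition by (auto simp: uniform_partition_def disjoint_family_on_def)

lemma cell_cover: "x \<in> unit_cube \<Longrightarrow> \<exists>i. x \<in> I i"
  using partition by (auto simp: uniform_partition_def)

lemma cell_sets_cube [measurable]: "I i \<in> sets cube_measure"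
  using cell_subset[of i] by (auto simp: sets_cube sets_restrict_space)

lemma measure_cell: "measure cube_measure (I i) = 1 / real CARD('m)"
  using partition cell_subset
  by (simp add: cube_measure_def measure_restrict_space uniform_partition_def)

lemma cell_nonempty: "I i \<noteq> {}"
  using measure_cell[of i] by force

lemma indicator_cell [measurable]:
  "(indicator (I i) :: _ \<Rightarrow> real) \<in> borel_measurable cube_measure"
  by measurable

definition step :: "real^'m \<Rightarrow> real^'d \<Rightarrow> real" where
  "step v x = (\<Sum>i\<in>UNIV. v $ i * indicator (I i) x)"

lemma step_cell: "x \<in> I i \<Longrightarrow> step v x = v $ i"
proof -
  assume "x \<in> I i"
  then have "indicator (I j) x = (if j = i then 1 else (0::real))" for j
    using cell_disjoint by (auto simp: indicator_def)
  then show ?thesis by (simp add: step_def if_distrib[where f = "\<lambda>z. _ * z"] cong: if_cong)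
qed

lemma step_sq_int: "step v \<in> sq_int"
proof -
  have [measurable]: "step v \<in> borel_measurable cube_measure"
    unfolding step_def by measurable
  have "\<bar>v $ i\<bar> \<le> norm v" for i by (rule component_le_norm_cart)
  then have "norm ((step v x)\<^sup>2) \<le> (norm v)\<^sup>2" if "x \<in> unit_cube" for x
    using cell_cover[OF that] by (auto simp: step_cell abs_le_square_iff[symmetric])
  then have "AE x in cube_measure. norm ((step v x)\<^sup>2) \<le> (norm v)\<^sup>2"
    by (intro AE_I2) simp
  then have "integrable cube_measure (\<lambda>x. (step v x)\<^sup>2)"
    by (intro cube.integrable_const_bound) auto
  then show ?thesis by (simp add: sq_int_def)
qed

lemma step_axis: "step (axis i 1) x = indicator (I i) x"
  by (simp add: step_def axis_def if_distrib[where f = "\<lambda>z. z * _"] cong: if_cong)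

text \<open>The embedding J of the overview, with values in classes of functions.\<close>

definition step_L2 :: "real^'m \<Rightarrow> 'd L2" where
  "step_L2 v = abs_L2 (step v)"

text \<open>The adjoint of J. The entries are integrals over the cells, not means, so that composing
  it with J gives 1/M times the identity.\<close>

definition cell_coeff :: "'d L2 \<Rightarrow> real^'m" where
  "cell_coeff \<psi> = (\<chi> i. \<psi> \<bullet> step_L2 (axis i 1))"

lemma linear_step_L2: "linear step_L2"
proof (rule linearI)
  show "step_L2 (v + w) = step_L2 v + step_L2 w" for v w
    by (simp add: step_L2_def plus_L2.abs_eq step_sq_int)
      (simp add: step_def[abs_def] sum.distrib distrib_right)
  show "step_L2 (r *\<^sub>R v) = r *\<^sub>R step_L2 v" for r v
    by (simp add: step_L2_def scaleR_L2.abs_eq step_sq_int)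
      (simp add: step_def[abs_def] sum_distrib_left mult.assoc)
qed

lemma inner_step_L2: "\<psi> \<bullet> step_L2 v = cell_coeff \<psi> \<bullet> v"
proof -
  have "step_L2 v = (\<Sum>i\<in>UNIV. v $ i *\<^sub>R step_L2 (axis i 1))"
    by (subst basis_expansion[symmetric, of v])
      (simp add: linear_sum[OF linear_step_L2] linear_cmul[OF linear_step_L2] scalar_mult_eq_scaleR)
  then show ?thesis
    by (simp add: inner_sum_right cell_coeff_def inner_vec_def[where 'b = 'm] mult.commute)
qed

lemma inner_step_L2_left: "step_L2 v \<bullet> \<psi> = v \<bullet> cell_coeff \<psi>"
  by (simp add: inner_step_L2 inner_commute)

lemma linear_cell_coeff: "linear cell_coeff"
  by (rule linearI) (simp_all add: cell_coeff_def vec_eq_iff inner_add_left)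

lemma cell_coeff_abs:
  "f \<in> sq_int \<Longrightarrow> cell_coeff (abs_L2 f) $ i = (\<integral>x. f x * indicator (I i) x \<partial>cube_measure)"
  by (simp add: cell_coeff_def step_L2_def inner_abs_L2 step_sq_int) (simp add: step_axis)

lemma cell_coeff_step_L2: "cell_coeff (step_L2 v) = v /\<^sub>R real CARD('m)"
proof -
  have "(\<integral>x. step v x * indicator (I i) x \<partial>cube_measure) = v $ i / real CARD('m)" for i
  proof -
    have "step v x * indicator (I i) x = v $ i * indicator (I i) x" for x
      by (auto simp: indicator_def step_cell)
    then have "(\<integral>x. step v x * indicator (I i) x \<partial>cube_measure) =
        (\<integral>x. v $ i * indicator (I i) x \<partial>cube_measure)"
      by (rule Bochner_Integration.integral_cong[OF refl])
    then show ?thesis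
      using cell_subset[of i] by (simp add: measure_cell Int_absorb2)
  qed
  then show ?thesis
    by (simp add: vec_eq_iff step_L2_def cell_coeff_abs step_sq_int divide_inverse mult.commute)
qed

lemma norm_step_L2: "norm (step_L2 v) = norm v / sqrt (real CARD('m))"
  by (simp add: norm_eq_sqrt_inner inner_step_L2 cell_coeff_step_L2 real_sqrt_divide divide_inverse
    real_sqrt_mult real_sqrt_inverse)

text \<open>Duality: Cauchy-Schwarz is applied to \<open>\<psi>\<close> and the step function built
  from its own coefficients, and one factor \<open>norm (cell_coeff \<psi>)\<close> is cancelled.
  This is why the zero case is split off.\<close>

lemma norm_cell_coeff_le: "norm (cell_coeff \<psi>) \<le> norm \<psi> / sqrt (real CARD('m))"
proof (cases "cell_coeff \<psi> = 0")
  case False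
  have "norm (cell_coeff \<psi>) * norm (cell_coeff \<psi>) = \<psi> \<bullet> step_L2 (cell_coeff \<psi>)"
    by (simp add: inner_step_L2 dot_square_norm power2_eq_square)
  also have "\<dots> \<le> norm \<psi> * norm (step_L2 (cell_coeff \<psi>))"
    by (rule norm_cauchy_schwarz)
  also have "\<dots> = norm \<psi> / sqrt (real CARD('m)) * norm (cell_coeff \<psi>)"
    by (simp add: norm_step_L2)
  finally show ?thesis using False by (simp add: mult_right_le_imp_le)
qed simp

lemma bounded_linear_step_L2: "bounded_linear step_L2"
  using linear_add[OF linear_step_L2] linear_cmul[OF linear_step_L2]
  by (rule bounded_linear_intro[where K = "1 / sqrt (real CARD('m))"])
    (simp add: norm_step_L2)

lemma bounded_linear_cell_coeff: "bounded_linear cell_coeff"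
  using linear_add[OF linear_cell_coeff] linear_cmul[OF linear_cell_coeff]
  by (rule bounded_linear_intro[where K = "1 / sqrt (real CARD('m))"])
    (use norm_cell_coeff_le in simp)

text \<open>J and its adjoint each contribute a factor 1 / sqrt M, so of the M^2 in the compression
  one factor M remains. Both the lower bound in (b) and the error bound for estimators are
  instances.\<close>

lemma compression_onorm_le:
  fixes T :: "'d L2 \<Rightarrow> 'd L2" and A :: "real^'m^'m"
  assumes T: "bounded_linear T"
    and A: "\<And>v. A *v v = (real CARD('m))\<^sup>2 *\<^sub>R cell_coeff (T (step_L2 v))"
  shows "onorm ((*v) A) / real CARD('m) \<le> onorm T"
proof -
  let ?M = "real CARD('m)"
  have "onorm ((*v) A) \<le> ?M * onorm T"
  proof (rule onorm_le)
    fix v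
    have "norm (A *v v) \<le> ?M\<^sup>2 * (norm (T (step_L2 v)) / sqrt ?M)"
      unfolding A norm_scaleR by (intro mult_mono norm_cell_coeff_le) simp_all
    also have "\<dots> \<le> ?M\<^sup>2 * (onorm T * norm (step_L2 v) / sqrt ?M)"
      by (intro mult_left_mono divide_right_mono onorm T) simp_all
    also have "\<dots> = ?M * onorm T * norm v"
      by (simp add: norm_step_L2 power2_eq_square)
    finally show "norm (A *v v) \<le> ?M * onorm T * norm v" .
  qed
  then show ?thesis by (simp add: pos_divide_le_eq mult.commute)
qed

section \<open>Block kernels and their operators\<close>

lemma block_kernel_step: "block_kernel I S x y = step (\<chi> i. step (S $ i) y) x"
  unfolding block_kernel_def step_def vec_lambda_beta sum_distrib_right
  by (intro sum.cong refl) (simp only: mult_ac)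

lemma block_kernel_cell: "x \<in> I i \<Longrightarrow> block_kernel I S x y = step (S $ i) y"
  by (simp add: block_kernel_step step_cell)

lemma step_outside: "x \<notin> unit_cube \<Longrightarrow> step v x = 0"
proof -
  assume "x \<notin> unit_cube"
  then have "x \<notin> I i" for i using cell_subset by blast
  then show ?thesis by (simp add: step_def)
qed

lemma block_kernel_outside: "x \<notin> unit_cube \<Longrightarrow> block_kernel I S x y = 0"
  by (simp add: block_kernel_step step_outside)

lemma block_kernel_integrable:
  assumes "f \<in> sq_int"
  shows "integrable cube_measure (\<lambda>y. block_kernel I S x y * f y)"
proof (cases "x \<in> unit_cube")
  case True
  then obtain i where "x \<in> I i" using cell_cover by blast
  then show ?thesis
    using assms by (simp add: block_kernel_cell sq_int_mult_integrable step_sq_int)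
qed (simp add: block_kernel_outside)

text \<open>For \<open>x\<close> in the cell \<open>I i\<close> the kernel is the step function of
  row \<open>i\<close> of \<open>S\<close>, so adjointness gives entry \<open>i\<close> of the
  matrix-vector product. Both sides vanish off the cube; the identity therefore holds for every
  \<open>x\<close> and can be rewritten inside a function of \<open>x\<close>.\<close>

lemma block_kernel_integral:
  assumes "f \<in> sq_int"
  shows "(\<integral>y. block_kernel I S x y * f y \<partial>cube_measure) = step (S *v cell_coeff (abs_L2 f)) x"
proof (cases "x \<in> unit_cube")
  case True
  then obtain i where i: "x \<in> I i" using cell_cover by blast
  have "(\<integral>y. block_kernel I S x y * f y \<partial>cube_measure) = step_L2 (S $ i) \<bullet> abs_L2 f"
    using assms i by (simp add: block_kernel_cell step_L2_def inner_abs_L2 step_sq_int)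
  then show ?thesis
    using i by (simp add: step_cell inner_step_L2_left matrix_vector_mul_component)
qed (simp add: block_kernel_outside step_outside)

lemma block_operator_eq: "block_operator I S \<psi> = step_L2 (S *v cell_coeff \<psi>)"
  by (simp add: block_operator_def integral_operator_def step_L2_def block_kernel_integral)

lemma bounded_linear_block_operator: "bounded_linear (block_operator I S)"
proof -
  have "bounded_linear (\<lambda>\<psi>. S *v cell_coeff \<psi>)"
    by (rule bounded_linear_compose[OF matrix_vector_mul_bounded_linear bounded_linear_cell_coeff])
  then show ?thesis
    unfolding block_operator_eq[abs_def]
    by (rule bounded_linear_compose[OF bounded_linear_step_L2])
qed

text \<open>J composed with its adjoint on the left is 1/M, and this occurs once on either side of
  \<open>S\<close>; the factor M^2 makes the compression return \<open>S\<close> exactly.\<close>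

lemma cell_coeff_block_operator:
  "(real CARD('m))\<^sup>2 *\<^sub>R cell_coeff (block_operator I S (step_L2 v)) = S *v v"
  unfolding block_operator_eq cell_coeff_step_L2 matrix_vector_mult_scaleR
  by (simp add: power2_eq_square field_simps)

lemma L2_kernel_block_kernel: "L2_kernel (block_kernel I S)"
proof -
  have "(\<lambda>(x, y). block_kernel I S x y) \<in> borel_measurable (cube_measure \<Otimes>\<^sub>M cube_measure)"
    unfolding block_kernel_def by measurable
  then show ?thesis
    using bounded_linear_block_operator[of S]
    by (simp add: L2_kernel_def block_operator_def block_kernel_integral block_kernel_integrable
      step_sq_int)
qed

lemma psd_block_operator:
  assumes "psd_matrix S"
  shows "psd_operator (block_operator I S)"
proof -
  have "(S *v v) \<bullet> w = v \<bullet> (S *v w)" for v w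
    using assms by (metis dot_lmul_matrix psd_matrix_def transpose_matrix_vector)
  then show ?thesis
    using assms
    by (simp add: psd_operator_def bounded_linear_block_operator block_operator_eq inner_step_L2
      inner_step_L2_left psd_matrix_def)
qed

text \<open>A positive operator is its own absolute value, and the block operator vanishes on the
  orthogonal complement of the normalized cell indicators, so that only finitely many diagonal
  coefficients are nonzero in a basis extending them.\<close>

lemma trace_class_block_operator:
  assumes "psd_matrix S"
  shows "trace_class (block_operator I S)"
proof -
  let ?C = "block_operator I S"
  have psd: "psd_operator ?C" by (rule psd_block_operator) fact
  then have adj: "adjoint ?C = ?C"
    by (intro adjoint_unique) (simp add: psd_operator_def)
  \<comment> \<open>J divides norms by sqrt M, so the entry sqrt M makes these cell indicators unit
    vectors.\<close>
  define b where "b i = step_L2 (axis i (sqrt (real CARD('m))))" for i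
  have bb: "b i \<bullet> b j = (if i = j then 1 else 0)" for i j
    by (auto simp: b_def inner_step_L2 cell_coeff_step_L2 inner_axis_axis divide_inverse)
  have "pairwise orthogonal (range b)" "\<forall>e\<in>range b. norm e = 1"
    by (auto simp: pairwise_def orthogonal_def bb norm_eq_sqrt_inner)
  then obtain E where E: "range b \<subseteq> E" "orthonormal_basis E"
    by (rule orthonormal_basis_extension)
  have "e \<bullet> ?C e = 0" if "e \<in> E - range b" for e
  proof -
    have "e \<bullet> b i = 0" for i
      using that E by (auto simp: orthonormal_basis_def pairwise_def orthogonal_def)
    then have "cell_coeff e = 0"
      by (simp add: b_def inner_step_L2 inner_axis vec_eq_iff)
    then show ?thesis by (simp add: block_operator_eq inner_step_L2)
  qed
  then have "(\<lambda>e. e \<bullet> ?C e) summable_on E \<longleftrightarrow> (\<lambda>e. e \<bullet> ?C e) summable_on range b"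
    using E by (intro summable_on_cong_neutral) auto
  then have "(\<lambda>e. e \<bullet> ?C e) summable_on E" by simp
  then show ?thesis
    using psd E adj bounded_linear_block_operator by (auto simp: trace_class_def)
qed

text \<open>The lower bound holds because \<open>S\<close> is the compression of its own block
  operator; the upper bound multiplies the factors 1 / sqrt M of J and of its adjoint.\<close>

lemma onorm_block_operator: "onorm (block_operator I S) = onorm ((*v) S) / real CARD('m)"
proof (rule antisym)
  let ?M = "real CARD('m)"
  show "onorm ((*v) S) / ?M \<le> onorm (block_operator I S)"
    by (rule compression_onorm_le[OF bounded_linear_block_operator])
      (rule cell_coeff_block_operator[symmetric])
  show "onorm (block_operator I S) \<le> onorm ((*v) S) / ?M"
  proof (rule onorm_bound)
    show "0 \<le> onorm ((*v) S) / ?M"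
      by (simp add: onorm_pos_le matrix_vector_mul_bounded_linear)
    fix \<psi>
    have "norm (block_operator I S \<psi>) = norm (S *v cell_coeff \<psi>) / sqrt ?M"
      by (simp add: block_operator_eq norm_step_L2)
    also have "\<dots> \<le> onorm ((*v) S) * norm (cell_coeff \<psi>) / sqrt ?M"
      by (intro divide_right_mono onorm matrix_vector_mul_bounded_linear) simp
    also have "\<dots> \<le> onorm ((*v) S) * (norm \<psi> / sqrt ?M) / sqrt ?M"
      by (intro divide_right_mono mult_left_mono norm_cell_coeff_le onorm_pos_le matrix_vector_mul_bounded_linear) simp_all
    finally show "norm (block_operator I S \<psi>) \<le> onorm ((*v) S) / ?M * norm \<psi>"
      by simp
  qed
qed

end


section \<open>Uniqueness of multivariate laws\<close>

text \<open>One-dimensional uniqueness under a nonnegative weight: the measure with density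
  \<open>f\<close>, normalized and pushed forward along \<open>Y\<close>, is a probability measure
  on the line, to which Levy's theorem applies. Cosines with a free phase keep all hypotheses
  real-valued.\<close>

lemma weighted_law_unique:
  fixes M N :: "'a measure" and f Y :: "'a \<Rightarrow> real"
  assumes "prob_space M" "prob_space N" and sets_N: "sets N = sets M"
    and f [measurable]: "f \<in> borel_measurable M" and Y [measurable]: "Y \<in> borel_measurable M"
    and f_nonneg: "\<And>x. 0 \<le> f x" and f_le: "\<And>x. f x \<le> K"
    and eq: "\<And>s \<psi>. (\<integral>x. f x * cos (s * Y x + \<psi>) \<partial>M) = (\<integral>x. f x * cos (s * Y x + \<psi>) \<partial>N)"
    and B [measurable]: "B \<in> sets borel"
  shows "(\<integral>x. f x * indicator B (Y x) \<partial>M) = (\<integral>x. f x * indicator B (Y x) \<partial>N)"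
proof -
  interpret M: prob_space M by fact
  interpret N: prob_space N by fact
  note [measurable_cong] = sets_N
  have int: "integrable L (\<lambda>x. f x * g x)"
    if "prob_space L" "sets L = sets M" "\<And>x. \<bar>g x\<bar> \<le> 1" "g \<in> borel_measurable M" for L g
  proof -
    interpret prob_space L by fact
    note [measurable_cong] = that(2)
    have [measurable]: "g \<in> borel_measurable M" by fact
    have "norm (f x * g x) \<le> K" for x
      using f_nonneg[of x] f_le[of x] that(3)[of x]
      by (auto simp: abs_mult intro: order_trans[OF mult_left_le])
    then show ?thesis by (intro integrable_const_bound[where B = K]) auto
  qed
  define c where "c = (\<integral>x. f x \<partial>M)"
  \<comment> \<open>At frequency and phase zero the hypothesis says that the two weighted measures
    have the same total mass.\<close>
  have cN: "c = (\<integral>x. f x \<partial>N)" using eq[of 0 0] by (simp add: c_def)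
  have intf: "integrable M f" "integrable N f"
    using int[of M "\<lambda>_. 1"] int[of N "\<lambda>_. 1"] sets_N M.prob_space_axioms N.prob_space_axioms by auto
  show ?thesis
  proof (cases "c = 0")
    \<comment> \<open>Mass zero rules out normalizing, but then the weight vanishes almost
      everywhere under both measures.\<close>
    case True
    then have "AE x in M. f x = 0" "AE x in N. f x = 0"
      using integral_nonneg_eq_0_iff_AE[OF intf(1)] integral_nonneg_eq_0_iff_AE[OF intf(2)] f_nonneg
      by (auto simp: c_def cN[symmetric])
    then have "(\<integral>x. f x * indicator B (Y x) \<partial>M) = 0" "(\<integral>x. f x * indicator B (Y x) \<partial>N) = 0"
      by (auto intro!: integral_eq_zero_AE elim: eventually_mono)
    then show ?thesis by simp
  next
    case False
    moreover have "c \<ge> 0" unfolding c_def using f_nonneg by (intro integral_nonneg_AE) auto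
    ultimately have c: "c > 0" by simp
    \<comment> \<open>The facts are proved for a generic \<open>L\<close> and then used for both
      measures. The phase \<open>- (pi / 2)\<close> turns the cosine into a sine, so the imaginary
      part of the characteristic function is covered by the hypothesis too.\<close>
    define D where "D L = distr (density L (\<lambda>x. ennreal (f x / c))) borel Y" for L
    have D: "real_distribution (D L)" "char (D L) t = (\<integral>x. f x * cos (t * Y x) \<partial>L) / c
        + \<i> * ((\<integral>x. f x * cos (t * Y x + - (pi / 2)) \<partial>L) / c)"
      "measure (D L) B = (\<integral>x. f x * indicator B (Y x) \<partial>L) / c"
      if "prob_space L" and sets: "sets L = sets M" and cL: "c = (\<integral>x. f x \<partial>L)" for L t
    proof -
      interpret prob_space L by fact
      note [measurable_cong] = sets
      have "integrable L f" using int[of L "\<lambda>_. 1"] that by auto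
      then have "(\<integral>\<^sup>+x. ennreal (f x / c) \<partial>L) = ennreal (\<integral>x. f x / c \<partial>L)"
        using c f_nonneg by (intro nn_integral_eq_integral) auto
      also have "\<dots> = 1" using c by (simp add: cL[symmetric])
      finally have "prob_space (density L (\<lambda>x. ennreal (f x / c)))"
        by (intro prob_spaceI) (simp add: emeasure_density cong: nn_integral_cong)
      then have "prob_space (D L)"
        unfolding D_def by (rule prob_space.prob_space_distr) simp
      then interpret DL: prob_space "D L" .
      show real: "real_distribution (D L)"
        by unfold_locales (simp_all add: D_def)
      have "measure (D L) B = (\<integral>y. indicator B y \<partial>D L)" by (simp add: D_def)
      also have "\<dots> = (\<integral>x. f x / c * indicator B (Y x) \<partial>L)"
        unfolding D_def using c f_nonneg
        by (subst integral_distr) (simp_all add: integral_density del: integral_indicator)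
      finally show "measure (D L) B = (\<integral>x. f x * indicator B (Y x) \<partial>L) / c"
        by simp
      have cos_sin: "cos (t * Y x + - (pi / 2)) = sin (t * Y x)" for x
        by (simp add: cos_diff)
      have "char (D L) t = (\<integral>x. (f x / c) *\<^sub>R iexp (t * Y x) \<partial>L)"
        unfolding D_def char_def using c f_nonneg by (simp add: integral_distr integral_density)
      also have "\<dots> = (\<integral>x. complex_of_real (f x / c * cos (t * Y x))
          + \<i> * complex_of_real (f x / c * sin (t * Y x)) \<partial>L)"
        by (intro Bochner_Integration.integral_cong refl)
          (simp add: scaleR_conv_of_real exp_Euler cos_of_real[symmetric] sin_of_real[symmetric] algebra_simps)
      also have "\<dots> = complex_of_real (\<integral>x. f x / c * cos (t * Y x) \<partial>L)
          + \<i> * complex_of_real (\<integral>x. f x / c * sin (t * Y x) \<partial>L)"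
      proof -
        have "integrable L (\<lambda>x. f x / c * cos (t * Y x))"
          "integrable L (\<lambda>x. f x / c * sin (t * Y x))"
          using int[OF that(1,2), of "\<lambda>x. cos (t * Y x)"]
            int[OF that(1,2), of "\<lambda>x. sin (t * Y x)"] by simp_all
        from this[THEN integrable_of_real[where 'a = complex]] show ?thesis
          by (subst Bochner_Integration.integral_add)
            (simp_all only: integrable_mult_right integral_mult_right_zero integral_complex_of_real)
      qed
      finally show "char (D L) t = (\<integral>x. f x * cos (t * Y x) \<partial>L) / c
        + \<i> * ((\<integral>x. f x * cos (t * Y x + - (pi / 2)) \<partial>L) / c)"
        unfolding cos_sin by simp
    qed
    note DM = D[OF M.prob_space_axioms refl c_def] and DN = D[OF N.prob_space_axioms sets_N cN]
    have "char (D M) = char (D N)"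
      unfolding DM(2) DN(2) fun_eq_iff using eq[of _ 0] eq[of _ "- (pi / 2)"] by simp
    then have "D M = D N"
      using Levy_uniqueness DM(1) DN(1) by blast
    then show ?thesis
      using DM(3) DN(3) c by simp
  qed
qed

text \<open>The characteristic function determines the law: starting from expectations of
  \<open>cos (t \<bullet> x + \<phi>)\<close>, indicators of intervals are introduced one coordinate at a time. For the
  step, the nonnegative weight \<open>1 + cos (t \<bullet> x + \<phi>)\<close> makes the law of a single coordinate a
  positive measure, whose characteristic function the product-to-sum formula expresses by known
  expectations, so that the one-dimensional uniqueness theorem applies.\<close>

theorem cramer_wold:
  fixes M N :: "(real^'m) measure"
  assumes "prob_space M" "prob_space N" and sets: "sets M = sets borel" "sets N = sets borel"
    and eq: "\<And>a. distr M borel (\<lambda>x. a \<bullet> x) = distr N borel (\<lambda>x. a \<bullet> x)"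
  shows "M = N"
proof -
  interpret M: prob_space M by fact
  interpret N: prob_space N by fact
  note [measurable_cong] = sets
  define w where "w A J x = (\<Prod>j\<in>J. indicator (A j) (x $ j) :: real)"
    for A :: "'m \<Rightarrow> real set" and J and x :: "real^'m"
  have w_bounds: "0 \<le> w A J x" "w A J x \<le> 1" for A J x
    unfolding w_def by (auto intro: prod_nonneg prod_le_1)
  have w_meas: "w A J \<in> borel_measurable borel" if "\<And>j. A j \<in> sets borel" for A J
    using that unfolding w_def by measurable
  have w_int: "integrable L (\<lambda>x. w A J x * cos (t \<bullet> x + \<phi>))"
    if "\<And>j. A j \<in> sets borel" "prob_space L" "sets L = sets borel" for A J t \<phi> and L :: "(real^'m) measure"
  proof -
    interpret prob_space L by fact
    note [measurable_cong] = that(3)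
    have [measurable]: "w A J \<in> borel_measurable borel" by (rule w_meas) fact
    have "norm (w A J x * cos (t \<bullet> x + \<phi>)) \<le> 1" for x
      using w_bounds[of A J x] by (auto simp: abs_mult intro!: mult_le_one)
    then show ?thesis by (intro integrable_const_bound[where B = 1]) auto
  qed
  \<comment> \<open>The frequency and the phase stay arbitrary in the induction because adding a
    coordinate shifts both.\<close>
  have main: "(\<integral>x. w A J x * cos (t \<bullet> x + \<phi>) \<partial>M) = (\<integral>x. w A J x * cos (t \<bullet> x + \<phi>) \<partial>N)"
    if A: "\<And>j. A j \<in> sets borel" and "finite J" for A J t \<phi>
    using \<open>finite J\<close>
  proof (induction J arbitrary: t \<phi>)
    case empty
    \<comment> \<open>With no indicators the integrand depends on \<open>x\<close> only through
      \<open>t \<bullet> x\<close>, whose law is the same under both measures.\<close>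
    have "(\<integral>x. cos (t \<bullet> x + \<phi>) \<partial>L) = (\<integral>y. cos (y + \<phi>) \<partial>distr L borel (\<lambda>x. t \<bullet> x))"
      if "sets L = sets borel" for L :: "(real^'m) measure"
      using that by (subst integral_distr) (auto cong: measurable_cong_sets)
    then show ?case by (simp add: w_def sets eq)
  next
    case (insert k J)
    have [measurable]: "w A J \<in> borel_measurable borel" by (rule w_meas) fact
    let ?f = "\<lambda>t \<phi> x. w A J x * (1 + cos (t \<bullet> x + \<phi>))"
    have *: "(\<integral>x. ?f t \<phi> x * indicator (A k) (x $ k) \<partial>M) = (\<integral>x. ?f t \<phi> x * indicator (A k) (x $ k) \<partial>N)"
      for t \<phi>
    proof (rule weighted_law_unique[OF M.prob_space_axioms N.prob_space_axioms, where K = 2])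
      show "0 \<le> ?f t \<phi> x" for x
        using w_bounds[of A J x] cos_ge_minus_one[of "t \<bullet> x + \<phi>"] by (intro mult_nonneg_nonneg) linarith+
      show "?f t \<phi> x \<le> 2" for x
        using mult_mono[of "w A J x" 1 "1 + cos (t \<bullet> x + \<phi>)" 2] w_bounds[of A J x]
          cos_ge_minus_one[of "t \<bullet> x + \<phi>"] cos_le_one[of "t \<bullet> x + \<phi>"] by linarith
      fix s \<psi>
      \<comment> \<open>The frequency \<open>s\<close> placed on coordinate \<open>k\<close>:
        product-to-sum then yields the frequencies \<open>t + u\<close> and \<open>t - u\<close>,
        together with \<open>u\<close> from the constant 1 in the weight.\<close>
      define u where "u = s *\<^sub>R (axis k 1 :: real^'m)"
      have u: "u \<bullet> x = s * x $ k" for x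
        by (simp add: u_def inner_axis')
      have "?f t \<phi> x * cos (s * x $ k + \<psi>) = w A J x * cos (u \<bullet> x + \<psi>)
          + w A J x * cos ((t + u) \<bullet> x + (\<phi> + \<psi>)) / 2
          + w A J x * cos ((t - u) \<bullet> x + (\<phi> - \<psi>)) / 2" for x
        using cos_times_cos[of "t \<bullet> x + \<phi>" "s * x $ k + \<psi>"]
        by (simp add: u inner_add_left inner_diff_left algebra_simps add_divide_distrib)
      moreover have int: "integrable M (\<lambda>x. w A J x * cos (t \<bullet> x + \<phi>))"
        "integrable N (\<lambda>x. w A J x * cos (t \<bullet> x + \<phi>))" for t \<phi>
        using w_int[OF A] sets M.prob_space_axioms N.prob_space_axioms by auto
      ultimately show "(\<integral>x. ?f t \<phi> x * cos (s * x $ k + \<psi>) \<partial>M) = (\<integral>x. ?f t \<phi> x * cos (s * x $ k + \<psi>) \<partial>N)"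
        using insert.IH by simp
    qed (use sets A in \<open>simp_all\<close>, measurable)
    \<comment> \<open>Removes the constant 1 of the weight: at frequency and phase zero the weight
      is twice \<open>w A J\<close>, hence the division by 2.\<close>
    have split: "w A (insert k J) x * cos (t \<bullet> x + \<phi>)
        = ?f t \<phi> x * indicator (A k) (x $ k) - ?f 0 0 x * indicator (A k) (x $ k) / 2" for x
      using insert.hyps by (simp add: w_def algebra_simps)
    have "integrable L (\<lambda>x. ?f t \<phi> x * indicator (A k) (x $ k))"
      if "prob_space L" "sets L = sets borel" for L t \<phi>
    proof -
      interpret prob_space L by fact
      note [measurable_cong] = that(2)
      have [measurable]: "A k \<in> sets borel" by (rule A)
      have *: "\<bar>1 + cos z\<bar> = 1 + cos z" for z :: real
        using cos_ge_minus_one[of z] by linarith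
      have "norm (?f t \<phi> x * indicator (A k) (x $ k)) \<le> 2" for x
        using mult_mono[of "w A J x" 1 "1 + cos (t \<bullet> x + \<phi>)" 2] w_bounds[of A J x]
          cos_ge_minus_one[of "t \<bullet> x + \<phi>"] cos_le_one[of "t \<bullet> x + \<phi>"]
        by (simp add: indicator_def abs_mult *)
      then show ?thesis by (intro integrable_const_bound[where B = 2]) auto
    qed
    then have "integrable M (\<lambda>x. ?f t \<phi> x * indicator (A k) (x $ k))"
       "integrable N (\<lambda>x. ?f t \<phi> x * indicator (A k) (x $ k))" for t \<phi>
       using sets M.prob_space_axioms N.prob_space_axioms by blast+
    then show ?case
      unfolding split by (simp only: Bochner_Integration.integral_diff integrable_divide
          integral_divide_zero *)
  qed
  have box: "emeasure M (box a b) = emeasure N (box a b)" for a b :: "real^'m"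
  proof -
    \<comment> \<open>All coordinates are used and the cosine is 1, which leaves the indicator of an
      open box; open boxes form an intersection-stable generator.\<close>
    have "w (\<lambda>j. {a $ j<..<b $ j}) UNIV x * cos (0 \<bullet> x + 0) = indicator (box a b) x" for x
      by (auto simp: w_def mem_box_cart indicator_def intro!: prod.neutral)
    then have "measure M (box a b) = measure N (box a b)"
      using main[of "\<lambda>j. {a $ j<..<b $ j}" UNIV 0 0] sets
      by (simp add: sets_eq_imp_space_eq[OF sets(1)] sets_eq_imp_space_eq[OF sets(2)])
    then show ?thesis by (simp add: M.emeasure_eq_measure N.emeasure_eq_measure)
  qed
  let ?E = "range (\<lambda>(a, b). box a b :: (real^'m) set)"
  show "M = N"
  proof (rule measure_eqI_generator_eq[where A = "\<lambda>n::nat. box (- (real n *\<^sub>R One)) (real n *\<^sub>R One)"])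
    show "Int_stable ?E" by (auto simp: Int_stable_def box_Int_box)
    show "sets M = sigma_sets UNIV ?E" "sets N = sigma_sets UNIV ?E"
      by (simp_all add: sets borel_eq_box)
    show "(\<Union>n::nat. box (- (real n *\<^sub>R One)) (real n *\<^sub>R One :: real^'m)) = UNIV"
      by (rule UN_box_eq_UNIV)
  qed (auto simp: box)
qed


section \<open>Laws of sample paths\<close>

text \<open>The generating family of \<open>path_space\<close> gets a name for case analysis and for
  induction over the sigma-algebra.\<close>

definition path_generators :: "(real^'d \<Rightarrow> real) set set" where
  "path_generators =
     {{u \<in> sq_int. u x \<in> B} | x B. x \<in> unit_cube \<and> B \<in> sets borel} \<union>
     {{u \<in> sq_int. (\<integral>x. u x * f x \<partial>cube_measure) \<in> B} | f B. f \<in> sq_int \<and> B \<in> sets borel}"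

lemma path_generators_subset: "path_generators \<subseteq> Pow sq_int"
  by (auto simp: path_generators_def)

lemma path_space_eq: "path_space = sigma sq_int path_generators"
  by (simp add: path_space_def path_generators_def)

lemma space_path_space [simp]: "space path_space = sq_int"
  unfolding path_space_eq using path_generators_subset by (rule space_measure_of)

lemma sets_path_space: "sets path_space = sigma_sets sq_int path_generators"
  unfolding path_space_eq using path_generators_subset by (rule sets_measure_of)

lemma path_generatorsE:
  assumes "A \<in> path_generators"
  obtains x B where "x \<in> unit_cube" "B \<in> sets borel" "A = {u \<in> sq_int. u x \<in> B}"
  | f B where "f \<in> sq_int" "B \<in> sets borel"
      "A = {u \<in> sq_int. (\<integral>x. u x * f x \<partial>cube_measure) \<in> B}"
  using assms unfolding path_generators_def by blast

lemma measurable_path_spaceI: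
  fixes u :: "'w \<Rightarrow> real^'d \<Rightarrow> real"
  assumes "\<And>w. w \<in> space P \<Longrightarrow> u w \<in> sq_int"
    and "\<And>x. x \<in> unit_cube \<Longrightarrow> (\<lambda>w. u w x) \<in> borel_measurable P"
    and "\<And>f. f \<in> sq_int \<Longrightarrow> (\<lambda>w. \<integral>x. u w x * f x \<partial>cube_measure) \<in> borel_measurable P"
  shows "u \<in> P \<rightarrow>\<^sub>M path_space"
  unfolding path_space_eq
proof (rule measurable_measure_of[OF path_generators_subset])
  show "u \<in> space P \<rightarrow> sq_int" using assms(1) by auto
  fix A :: "(real^'d \<Rightarrow> real) set" assume "A \<in> path_generators"
  then show "u -` A \<inter> space P \<in> sets P"
  proof (cases rule: path_generatorsE)
    case (1 x B)
    then have "u -` A \<inter> space P = (\<lambda>w. u w x) -` B \<inter> space P" using assms(1) by auto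
    then show ?thesis using assms(2) 1 by (simp add: measurable_sets)
  next
    case (2 f B)
    then have "u -` A \<inter> space P = (\<lambda>w. \<integral>x. u w x * f x \<partial>cube_measure) -` B \<inter> space P"
      using assms(1) by auto
    then show ?thesis using assms(3) 2 by (simp add: measurable_sets)
  qed
qed

text \<open>The sets whose preimages under the two processes agree up to a null set form a sigma-algebra,
  so it suffices to compare the generators.\<close>

lemma path_law_cong:
  fixes u v :: "'w \<Rightarrow> real^'d \<Rightarrow> real"
  assumes u: "u \<in> P \<rightarrow>\<^sub>M path_space" and v: "v \<in> P \<rightarrow>\<^sub>M path_space"
    and eval: "\<And>x. x \<in> unit_cube \<Longrightarrow> AE w in P. u w x = v w x"
    and inner: "\<And>f. f \<in> sq_int \<Longrightarrow>
      AE w in P. (\<integral>x. u w x * f x \<partial>cube_measure) = (\<integral>x. v w x * f x \<partial>cube_measure)"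
  shows "distr P path_space u = distr P path_space v"
proof (rule measure_eqI)
  have sq: "u w \<in> sq_int" "v w \<in> sq_int" if "w \<in> space P" for w
    using that u v by (auto dest: measurable_space)
  fix A assume A: "A \<in> sets (distr P path_space u)"
  then have "A \<in> sigma_sets sq_int path_generators"
    by (simp add: sets_path_space)
  then have "AE w in P. u w \<in> A \<longleftrightarrow> v w \<in> A"
  proof induction
    case (Basic A)
    then show ?case
    proof (cases rule: path_generatorsE)
      case (1 x B)
      show ?thesis
        using eval[OF 1(1)] AE_space by eventually_elim (simp add: 1 sq)
    next
      case (2 f B)
      show ?thesis
        using inner[OF 2(1)] AE_space by eventually_elim (simp add: 2 sq)
    qed
  next
    case (Compl A)
    show ?case
      using Compl.IH AE_space by eventually_elim (simp add: sq)
  next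
    case (Union A)
    have "AE w in P. \<forall>i. u w \<in> A i \<longleftrightarrow> v w \<in> A i"
      using Union.IH by (simp add: AE_all_countable)
    then show ?case by eventually_elim simp
  qed simp
  then have "AE w in P. w \<in> u -` A \<inter> space P \<longleftrightarrow> w \<in> v -` A \<inter> space P"
    by (auto elim: eventually_mono)
  then have "emeasure P (u -` A \<inter> space P) = emeasure P (v -` A \<inter> space P)"
    using A u v by (intro emeasure_eq_AE) (auto intro: measurable_sets)
  then show "emeasure (distr P path_space u) A = emeasure (distr P path_space v) A"
    using A u v by (simp add: emeasure_distr)
qed simp

text \<open>\<open>centered_normal 0\<close> is the image of the standard normal law under the zero
  map, hence the point mass at 0.\<close>

lemma AE_zero_if_centered_normal_zero:
  assumes X [measurable]: "X \<in> borel_measurable P" and law: "distr P borel X = centered_normal 0"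
  shows "AE w in P. X w = 0"
proof -
  have "AE y in centered_normal 0. y = 0"
    unfolding centered_normal_def by (subst AE_distr_iff) auto
  then have "AE y in distr P borel X. y = 0" unfolding law .
  then show ?thesis by (subst (asm) AE_distr_iff) auto
qed

lemma gaussian_vector_law_unique:
  assumes "prob_space P" "prob_space Q" and X: "gaussian_vector P S X" and Y: "gaussian_vector Q S Y"
  shows "distr P borel X = distr Q borel Y"
proof (rule cramer_wold)
  have [measurable]: "X \<in> borel_measurable P" "Y \<in> borel_measurable Q"
    using X Y by (auto simp: gaussian_vector_def)
  show "prob_space (distr P borel X)" "prob_space (distr Q borel Y)"
    using assms(1,2) by (auto intro!: prob_space.prob_space_distr)
  show "distr (distr P borel X) borel (\<lambda>x. a \<bullet> x) = distr (distr Q borel Y) borel (\<lambda>x. a \<bullet> x)" for a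
    using X Y by (simp add: distr_distr comp_def gaussian_vector_def)
qed simp_all

text \<open>The triangle inequality bounds the change of the norm by the sum of the entrywise
  changes. Continuity makes the error of a measurable matrix estimator a measurable function of the
  data.\<close>

lemma continuous_on_onorm_matrix: "continuous_on UNIV (\<lambda>A :: real^'m^'m. onorm ((*v) A))"
proof -
  have tri: "onorm ((*v) A) \<le> onorm ((*v) B) + (\<Sum>i\<in>UNIV. \<Sum>j\<in>UNIV. \<bar>A $ i $ j - B $ i $ j\<bar>)"
    for A B :: "real^'m^'m"
  proof -
    have "onorm ((*v) A) = onorm (\<lambda>v. B *v v + (A - B) *v v)"
      by (simp add: matrix_vector_mult_diff_rdistrib)
    also have "\<dots> \<le> onorm ((*v) B) + onorm ((*v) (A - B))"
      by (rule onorm_triangle) auto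
    also have "onorm ((*v) (A - B)) \<le> (\<Sum>i\<in>UNIV. \<Sum>j\<in>UNIV. \<bar>A $ i $ j - B $ i $ j\<bar>)"
      using onorm_le_matrix_component_sum[of "A - B"] by simp
    finally show ?thesis by simp
  qed
  show ?thesis
    unfolding continuous_on_def
  proof
    fix A :: "real^'m^'m"
    have "((\<lambda>B. \<Sum>i\<in>UNIV. \<Sum>j\<in>UNIV. \<bar>B $ i $ j - A $ i $ j\<bar>) \<longlongrightarrow>
        (\<Sum>i\<in>UNIV. \<Sum>j\<in>UNIV. \<bar>A $ i $ j - A $ i $ j\<bar>)) (at A)"
      by (intro tendsto_intros)
    then have lim: "((\<lambda>B. \<Sum>i\<in>UNIV. \<Sum>j\<in>UNIV. \<bar>B $ i $ j - A $ i $ j\<bar>) \<longlongrightarrow> 0) (at A)"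
      by simp
    have "\<bar>onorm ((*v) B) - onorm ((*v) A)\<bar> \<le> (\<Sum>i\<in>UNIV. \<Sum>j\<in>UNIV. \<bar>B $ i $ j - A $ i $ j\<bar>)" for B
      using tri[of A B] tri[of B A] by (simp add: abs_minus_commute)
    then have "((\<lambda>B. onorm ((*v) B) - onorm ((*v) A)) \<longlongrightarrow> 0) (at A)"
      by (intro Lim_null_comparison[OF _ lim]) simp
    then show "((\<lambda>A. onorm ((*v) A)) \<longlongrightarrow> onorm ((*v) A)) (at A)"
      by (simp add: LIM_zero_iff)
  qed
qed

section \<open>Gaussian processes with block covariance\<close>

context cube_partition
begin

text \<open>An inner product of \<open>step v\<close> with a fixed function is linear in
  \<open>v\<close>, by adjointness, so both kinds of generators of \<open>path_space\<close> have
  Borel preimages.\<close>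

lemma measurable_step: "step \<in> borel \<rightarrow>\<^sub>M path_space"
proof (rule measurable_path_spaceI)
  show "(\<lambda>v. step v x) \<in> borel_measurable borel" for x
    unfolding step_def by measurable
  show "(\<lambda>v. \<integral>x. step v x * f x \<partial>cube_measure) \<in> borel_measurable borel" if "f \<in> sq_int" for f
  proof -
    have "(\<integral>x. step v x * f x \<partial>cube_measure) = v \<bullet> cell_coeff (abs_L2 f)" for v
      using that by (simp add: inner_step_L2_left[symmetric] step_L2_def inner_abs_L2 step_sq_int)
    then show ?thesis by simp
  qed
qed (rule step_sq_int)

definition node :: "'m \<Rightarrow> real^'d" where
  "node i = (SOME x. x \<in> I i)"

lemma node_in: "node i \<in> I i"
  unfolding node_def using cell_nonempty by (simp add: some_in_eq)

lemma node_in_cube: "node i \<in> unit_cube"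
  using node_in cell_subset by blast

lemma inj_node: "inj node"
  using node_in cell_disjoint by (metis injI)

text \<open>A left inverse of \<open>step\<close>. Point values are used instead of cell averages
  because the Gaussian law of a process is specified through finitely many evaluations.\<close>

definition sample :: "(real^'d \<Rightarrow> real) \<Rightarrow> real^'m" where
  "sample f = (\<chi> i. f (node i))"

lemma block_kernel_cells: "x \<in> I i \<Longrightarrow> y \<in> I j \<Longrightarrow> block_kernel I S x y = S $ i $ j"
  by (simp add: block_kernel_cell step_cell)

lemma gaussian_process_eval_measurable:
  assumes "gaussian_process P k u" "x \<in> unit_cube"
  shows "(\<lambda>w. u w x) \<in> borel_measurable P"
proof -
  have u: "(\<lambda>(w, x). u w x) \<in> borel_measurable (P \<Otimes>\<^sub>M cube_measure)"
    using assms by (simp add: gaussian_process_def)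
  have "(\<lambda>w. (w, x)) \<in> P \<rightarrow>\<^sub>M (P \<Otimes>\<^sub>M cube_measure)"
    using assms(2) by (intro measurable_Pair2') simp
  from measurable_compose[OF this u] show ?thesis by simp
qed

lemma gaussian_process_linear_combination:
  assumes "gaussian_process P k u" "finite T" "T \<subseteq> unit_cube"
  shows "distr P borel (\<lambda>w. \<Sum>x\<in>T. c x * u w x) =
    centered_normal (\<Sum>x\<in>T. \<Sum>y\<in>T. c x * c y * k x y)"
  using assms unfolding gaussian_process_def by blast

lemma gaussian_vector_sample:
  assumes u: "gaussian_process P (block_kernel I S) u"
  shows "gaussian_vector P S (\<lambda>w. sample (u w))"
  unfolding gaussian_vector_def
proof (intro conjI allI)
  show "(\<lambda>w. sample (u w)) \<in> borel_measurable P"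
    unfolding sample_def
    using gaussian_process_eval_measurable[OF u node_in_cube]
    by (subst borel_measurable_euclidean_space) (auto simp: Basis_vec_def inner_axis)
  fix a :: "real^'m"
  \<comment> \<open>The laws of a process are indexed by sets of points, so the coefficients are
    carried from indices to points along the injective map \<open>node\<close>.\<close>
  let ?c = "\<lambda>x. a $ inv node x"
  have "distr P borel (\<lambda>w. \<Sum>x\<in>range node. ?c x * u w x) =
      centered_normal (\<Sum>x\<in>range node. \<Sum>y\<in>range node. ?c x * ?c y * block_kernel I S x y)"
    using node_in_cube by (intro gaussian_process_linear_combination[OF u]) (simp_all add: image_subset_iff)
  also have "(\<Sum>x\<in>range node. \<Sum>y\<in>range node. ?c x * ?c y * block_kernel I S x y)
      = (\<Sum>i\<in>UNIV. \<Sum>j\<in>UNIV. a $ i * a $ j * S $ i $ j)"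
    by (simp add: sum.reindex[OF inj_node] inv_f_f[OF inj_node] block_kernel_cells[OF node_in node_in])
  also have "\<dots> = a \<bullet> (S *v a)"
    by (simp add: inner_vec_def matrix_vector_mult_def sum_distrib_left mult_ac)
  also have "(\<lambda>w. \<Sum>x\<in>range node. ?c x * u w x) = (\<lambda>w. a \<bullet> sample (u w))"
    by (simp add: sum.reindex[OF inj_node] inv_f_f[OF inj_node] inner_vec_def sample_def)
  finally show "distr P borel (\<lambda>w. a \<bullet> sample (u w)) = centered_normal (a \<bullet> (S *v a))" .
qed

text \<open>For \<open>x\<close> in \<open>I i\<close>, all four covariances of the pair
  \<open>x\<close>, \<open>node i\<close> equal the diagonal entry \<open>S $ i $ i\<close>, so the
  difference of the two values has variance 0.\<close>

lemma gaussian_process_const_on_cell: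
  assumes u: "gaussian_process P (block_kernel I S) u" and x: "x \<in> unit_cube"
  shows "AE w in P. u w x = step (sample (u w)) x"
proof -
  obtain i where i: "x \<in> I i" using cell_cover[OF x] by blast
  then have eq: "step (sample (u w)) x = u w (node i)" for w
    by (simp add: step_cell sample_def)
  show ?thesis
  proof (cases "x = node i")
    \<comment> \<open>Distinctness makes the set \<open>{x, node i}\<close> have two elements, so
      that the combination below is really a difference.\<close>
    case False
    define c where "c y = (if y = x then 1 else - 1 :: real)" for y
    have "distr P borel (\<lambda>w. \<Sum>y\<in>{x, node i}. c y * u w y) =
      centered_normal (\<Sum>y\<in>{x, node i}. \<Sum>z\<in>{x, node i}. c y * c z * block_kernel I S y z)"
      using x node_in_cube[of i] by (intro gaussian_process_linear_combination[OF u]) simp_all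
    then have "distr P borel (\<lambda>w. u w x - u w (node i)) = centered_normal 0"
      using False i node_in[of i] by (simp add: c_def block_kernel_cells)
    then have "AE w in P. u w x - u w (node i) = 0"
      using gaussian_process_eval_measurable[OF u] x node_in_cube[of i]
      by (intro AE_zero_if_centered_normal_zero) auto
    then show ?thesis by (simp add: eq)
  qed (use eq in simp)
qed

lemma gaussian_process_path_law:
  assumes "prob_space P" and u: "gaussian_process P (block_kernel I S) u"
    and u_path: "u \<in> P \<rightarrow>\<^sub>M path_space"
  shows "distr P path_space u = distr P path_space (\<lambda>w. step (sample (u w)))"
proof (rule path_law_cong[OF u_path])
  have U [measurable]: "(\<lambda>w. sample (u w)) \<in> borel_measurable P"
    using gaussian_vector_sample[OF u] by (simp add: gaussian_vector_def)
  show "(\<lambda>w. step (sample (u w))) \<in> P \<rightarrow>\<^sub>M path_space"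
    using measurable_compose[OF U measurable_step] .
  show "AE w in P. u w x = step (sample (u w)) x" if "x \<in> unit_cube" for x
    by (rule gaussian_process_const_on_cell[OF u that])
  interpret P: prob_space P by fact
  interpret C: pair_sigma_finite P "cube_measure :: (real^'d) measure" ..
  have [measurable]: "(\<lambda>(w, x). u w x) \<in> borel_measurable (P \<Otimes>\<^sub>M cube_measure)"
    using u by (simp add: gaussian_process_def)
  have [measurable]: "(\<lambda>w. sample (u w) $ i) \<in> borel_measurable P" for i
    using U by (rule measurable_compose) simp
  have [measurable]: "(\<lambda>z. step (sample (u (fst z))) (snd z)) \<in> borel_measurable (P \<Otimes>\<^sub>M cube_measure)"
    unfolding step_def by measurable
  \<comment> \<open>The exceptional null set of \<open>w\<close> depends on the point
    \<open>x\<close>. Joint measurability allows the quantifiers to be exchanged, giving almost sure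
    equality of whole paths up to a null set of the cube.\<close>
  have "(AE w in P. AE x in cube_measure. u w x = step (sample (u w)) x) \<longleftrightarrow>
      (AE x in cube_measure. AE w in P. u w x = step (sample (u w)) x)"
    by (rule C.AE_commute) measurable
  moreover have "AE x in cube_measure. AE w in P. u w x = step (sample (u w)) x"
    by (rule AE_I2) (simp add: gaussian_process_const_on_cell[OF u])
  ultimately have AE: "AE w in P. AE x in cube_measure. u w x = step (sample (u w)) x"
    by blast
  show "AE w in P. (\<integral>x. u w x * f x \<partial>cube_measure) = (\<integral>x. step (sample (u w)) x * f x \<partial>cube_measure)"
    if "f \<in> sq_int" for f
    using AE AE_space
  proof eventually_elim
    case (elim w)
    have "u w \<in> sq_int" using u elim by (simp add: gaussian_process_def)
    from this[THEN sq_int_measurable] that[THEN sq_int_measurable] step_sq_int[THEN sq_int_measurable]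
    show ?case
      using elim by (intro integral_cong_AE) auto
  qed
qed

end

section \<open>Joint laws of independent observations\<close>

lemma iid_joint_law_cong:
  fixes Y Z :: "nat \<Rightarrow> _ \<Rightarrow> _"
  assumes "prob_space P" "prob_space Q"
    and Y: "prob_space.indep_vars P (\<lambda>_. L) Y {..<N}"
    and Z: "prob_space.indep_vars Q (\<lambda>_. L) Z {..<N}"
    and law: "\<And>n. n < N \<Longrightarrow> distr P L (Y n) = distr Q L (Z n)"
  shows "distr P (\<Pi>\<^sub>M n\<in>{..<N}. L) (\<lambda>w. \<lambda>n\<in>{..<N}. Y n w) =
    distr Q (\<Pi>\<^sub>M n\<in>{..<N}. L) (\<lambda>w. \<lambda>n\<in>{..<N}. Z n w)"
proof -
  interpret P: prob_space P by fact
  interpret Q: prob_space Q by fact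
  have mY: "Y n \<in> P \<rightarrow>\<^sub>M L" and mZ: "Z n \<in> Q \<rightarrow>\<^sub>M L" if "n \<in> {..<N}" for n
    using Y Z that by (auto simp: P.indep_vars_def Q.indep_vars_def)
  show ?thesis
  proof (cases "N = 0")
    \<comment> \<open>The characterization of independence by product measures, used in the other
      case, is for nonempty index sets. Without observations the product space has a single
      point.\<close>
    case True
    show ?thesis
    proof (rule measure_eqI)
      fix A assume "A \<in> sets (distr P (\<Pi>\<^sub>M n\<in>{..<N}. L) (\<lambda>w. \<lambda>n\<in>{..<N}. Y n w))"
      then have "A = {} \<or> A = {\<lambda>_. undefined}"
        using True by (auto simp: PiM_empty)
      then show "emeasure (distr P (\<Pi>\<^sub>M n\<in>{..<N}. L) (\<lambda>w. \<lambda>n\<in>{..<N}. Y n w)) A =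
          emeasure (distr Q (\<Pi>\<^sub>M n\<in>{..<N}. L) (\<lambda>w. \<lambda>n\<in>{..<N}. Z n w)) A"
        using True by (auto simp: PiM_empty emeasure_distr restrict_def
            P.emeasure_space_1 Q.emeasure_space_1)
    qed simp
  next
    case False
    then have ne: "{..<N} \<noteq> {}" by auto
    show ?thesis
      using P.indep_vars_iff_distr_eq_PiM'[OF ne mY, THEN iffD1, OF _ Y]
        Q.indep_vars_iff_distr_eq_PiM'[OF ne mZ, THEN iffD1, OF _ Z] law
      by (auto intro!: PiM_cong)
  qed
qed

context cube_partition
begin

text \<open>Each path has the law of the step function of its samples, and the samples share the law
  of \<open>X n\<close>; pushing this law forward along \<open>step\<close> identifies the
  marginals, and independence the joint laws, across two probability spaces.\<close>

lemma iid_path_law: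
  assumes u: "iid_gaussian_processes P N (block_kernel I S) u"
    and X: "iid_gaussian_vectors Q N S X"
  shows "distr P (\<Pi>\<^sub>M n\<in>{..<N}. path_space) (\<lambda>w. \<lambda>n\<in>{..<N}. u n w) =
    distr Q (\<Pi>\<^sub>M n\<in>{..<N}. path_space) (\<lambda>w. \<lambda>n\<in>{..<N}. step (X n w))"
proof (rule iid_joint_law_cong)
  show P: "prob_space P" and Q: "prob_space Q"
    and ind_u: "prob_space.indep_vars P (\<lambda>_. path_space) u {..<N}"
    using u X by (simp_all add: iid_gaussian_processes_def iid_gaussian_vectors_def)
  interpret P: prob_space P by fact
  interpret Q: prob_space Q by fact
  show "Q.indep_vars (\<lambda>_. path_space) (\<lambda>n w. step (X n w)) {..<N}"
  proof (rule Q.indep_vars_compose2)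
    show "Q.indep_vars (\<lambda>_. borel) X {..<N}"
      using X by (simp add: iid_gaussian_vectors_def)
  qed (rule measurable_step)
  fix n assume n: "n < N"
  have un: "gaussian_process P (block_kernel I S) (u n)" and Xn: "gaussian_vector Q S (X n)"
    using u X n by (simp_all add: iid_gaussian_processes_def iid_gaussian_vectors_def)
  have path: "u n \<in> P \<rightarrow>\<^sub>M path_space"
    using ind_u n by (auto simp: P.indep_vars_def)
  have U: "gaussian_vector P S (\<lambda>w. sample (u n w))"
    by (rule gaussian_vector_sample[OF un])
  have m: "(\<lambda>w. sample (u n w)) \<in> borel_measurable P" "X n \<in> borel_measurable Q"
    using U Xn by (auto simp: gaussian_vector_def)
  have "distr P path_space (u n) = distr P path_space (\<lambda>w. step (sample (u n w)))"
    by (rule gaussian_process_path_law[OF P un path])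
  also have "\<dots> = distr (distr P borel (\<lambda>w. sample (u n w))) path_space step"
    using m measurable_step by (simp add: distr_distr comp_def)
  also have "\<dots> = distr (distr Q borel (X n)) path_space step"
    by (simp add: gaussian_vector_law_unique[OF P Q U Xn])
  also have "\<dots> = distr Q path_space (\<lambda>w. step (X n w))"
    using m measurable_step by (simp add: distr_distr comp_def)
  finally show "distr P path_space (u n) = distr Q path_space (\<lambda>w. step (X n w))" .
qed

end


section \<open>Compression of estimators\<close>

context cube_partition
begin

text \<open>The matrix of the compression of the integral operator, written out as double integrals
  of the kernel so that its dependence on the data is visibly measurable.\<close>

definition cell_matrix :: "(real^'d \<Rightarrow> real^'d \<Rightarrow> real) \<Rightarrow> real^'m^'m" where
  "cell_matrix k = (\<chi> i j. (real CARD('m))\<^sup>2 *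
     (\<integral>x. (\<integral>y. k x y * indicator (I j) y \<partial>cube_measure) * indicator (I i) x \<partial>cube_measure))"

text \<open>The compression is linear in \<open>v\<close>, hence given by a matrix, and its entries
  on the standard basis are integrals over pairs of cells.\<close>

lemma cell_matrix_mult:
  assumes k: "L2_kernel k"
  shows "cell_matrix k *v v = (real CARD('m))\<^sup>2 *\<^sub>R cell_coeff (integral_operator k (step_L2 v))"
proof -
  define T where "T v = cell_coeff (integral_operator k (step_L2 v))" for v
  have "linear (integral_operator k)"
    using k by (simp add: L2_kernel_def bounded_linear.linear)
  then have "linear T"
    unfolding T_def[abs_def]
    by (intro linear_compose[OF linear_step_L2, unfolded o_def] linear_compose[OF _ linear_cell_coeff, unfolded o_def])
  from matrix_vector_mul(2)[OF this] have "matrix T *v v = T v" by (rule fun_cong)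
  moreover have "cell_matrix k = (real CARD('m))\<^sup>2 *\<^sub>R matrix T"
  proof -
    have "T (axis j 1) $ i =
      (\<integral>x. (\<integral>y. k x y * indicator (I j) y \<partial>cube_measure) * indicator (I i) x \<partial>cube_measure)" for i j
    proof -
      have "(\<lambda>x. \<integral>y. k x y * step (axis j 1) y \<partial>cube_measure) \<in> sq_int"
        using k step_sq_int by (simp add: L2_kernel_def)
      then show ?thesis
        unfolding T_def step_L2_def integral_operator_abs[OF k step_sq_int]
        by (simp add: cell_coeff_abs step_axis)
    qed
    then show ?thesis
      by (simp add: cell_matrix_def matrix_def vec_eq_iff)
  qed
  ultimately show ?thesis
    by (simp add: scaleR_matrix_vector_assoc[symmetric] T_def)
qed

text \<open>Compression is linear and maps the block operator to \<open>S\<close>, so it maps the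
  operator error to the matrix error.\<close>

lemma cell_matrix_error:
  assumes k: "L2_kernel k"
  shows "onorm ((*v) (cell_matrix k - S)) / real CARD('m) \<le>
    onorm (\<lambda>\<psi>. integral_operator k \<psi> - block_operator I S \<psi>)"
proof -
  have T: "bounded_linear (\<lambda>\<psi>. integral_operator k \<psi> - block_operator I S \<psi>)"
    using k bounded_linear_block_operator by (intro bounded_linear_sub) (auto simp: L2_kernel_def)
  show ?thesis
    by (rule compression_onorm_le[OF T])
      (simp add: linear_diff[OF linear_cell_coeff] scaleR_diff_right cell_coeff_block_operator
        matrix_vector_mult_diff_rdistrib cell_matrix_mult[OF k])
qed

text \<open>After reassociating the product space, the two spatial variables are integrated out one
  at a time, each time with a measurable parameter.\<close>

lemma measurable_cell_matrix:
  assumes k: "(\<lambda>(u, x, y). k u x y) \<in> borel_measurable (L \<Otimes>\<^sub>M (cube_measure \<Otimes>\<^sub>M cube_measure))"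
  shows "(\<lambda>u. cell_matrix (k u)) \<in> borel_measurable L"
proof -
  have assoc: "(\<lambda>(z, y). (fst z, snd z, y)) \<in> (L \<Otimes>\<^sub>M cube_measure) \<Otimes>\<^sub>M cube_measure
      \<rightarrow>\<^sub>M L \<Otimes>\<^sub>M (cube_measure \<Otimes>\<^sub>M (cube_measure :: (real^'d) measure))"
    by measurable
  have [measurable]: "(\<lambda>z. k (fst (fst z)) (snd (fst z)) (snd z)) \<in>
      borel_measurable ((L \<Otimes>\<^sub>M cube_measure) \<Otimes>\<^sub>M cube_measure)"
    using measurable_compose[OF assoc k] by (simp add: split_def)
  have inner: "(\<lambda>z. \<integral>y. k (fst z) (snd z) y * indicator (I j) y \<partial>cube_measure)
      \<in> borel_measurable (L \<Otimes>\<^sub>M cube_measure)" for j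
    by (rule cube.borel_measurable_lebesgue_integral) (simp add: split_def)
  have "(\<lambda>u. \<integral>x. (\<integral>y. k u x y * indicator (I j) y \<partial>cube_measure) * indicator (I i) x \<partial>cube_measure)
      \<in> borel_measurable L" for i j
  proof (rule cube.borel_measurable_lebesgue_integral)
    note [measurable] = inner
    show "(\<lambda>(u, x). (\<integral>y. k u x y * indicator (I j) y \<partial>cube_measure) * indicator (I i) x)
      \<in> borel_measurable (L \<Otimes>\<^sub>M cube_measure)"
      unfolding split_def by measurable
  qed
  then show ?thesis
    unfolding cell_matrix_def
    by (subst borel_measurable_euclidean_space) (auto simp: Basis_vec_def inner_axis)
qed

text \<open>The matrix error \<open>g\<close> is a function of the tuple of paths, so equality of
  the joint laws allows it to be evaluated on the true processes instead of the synthetic paths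
  \<open>step (X n w)\<close>.\<close>

lemma matrix_risk_le_operator_risk:
  assumes k: "(\<lambda>(u, x, y). k u x y) \<in> borel_measurable
      ((\<Pi>\<^sub>M n\<in>{..<N}. path_space) \<Otimes>\<^sub>M (cube_measure \<Otimes>\<^sub>M cube_measure))"
    and L2: "\<And>u. u \<in> space (\<Pi>\<^sub>M n\<in>{..<N}. path_space) \<Longrightarrow> L2_kernel (k u)"
    and Chat: "\<And>u. u \<in> space (\<Pi>\<^sub>M n\<in>{..<N}. path_space) \<Longrightarrow> Chat u = integral_operator (k u)"
    and u: "iid_gaussian_processes P N (block_kernel I S) u"
    and X: "iid_gaussian_vectors Q N S X"
  shows "ennreal (1 / real CARD('m)) *
      matrix_risk Q N X (\<lambda>x. cell_matrix (k (\<lambda>n\<in>{..<N}. step (x n)))) S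
    \<le> operator_risk P N u Chat (block_operator I S)"
proof -
  let ?L = "\<Pi>\<^sub>M n\<in>{..<N}. (path_space :: (real^'d \<Rightarrow> real) measure)"
  let ?M = "real CARD('m)"
  define g where "g U = ennreal (onorm ((*v) (cell_matrix (k U) - S)))" for U
  have "(\<lambda>U. onorm ((*v) (cell_matrix (k U) - S))) \<in> borel_measurable ?L"
    using measurable_cell_matrix[OF k]
    by (intro measurable_compose[OF _ borel_measurable_continuous_onI[OF continuous_on_onorm_matrix]]
      borel_measurable_diff) auto
  then have g: "g \<in> borel_measurable ?L" unfolding g_def by measurable
  have um: "(\<lambda>w. \<lambda>n\<in>{..<N}. u n w) \<in> P \<rightarrow>\<^sub>M ?L"
    using u by (auto simp: iid_gaussian_processes_def prob_space.indep_vars_def intro!: measurable_restrict)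
  have Xm: "(\<lambda>w. \<lambda>n\<in>{..<N}. step (X n w)) \<in> Q \<rightarrow>\<^sub>M ?L"
    using X measurable_step
    by (auto simp: iid_gaussian_vectors_def gaussian_vector_def intro!: measurable_restrict measurable_compose[OF _ measurable_step])
  have "matrix_risk Q N X (\<lambda>x. cell_matrix (k (\<lambda>n\<in>{..<N}. step (x n)))) S
      = (\<integral>\<^sup>+w. g (\<lambda>n\<in>{..<N}. step (X n w)) \<partial>Q)"
    unfolding matrix_risk_def g_def by (simp cong: restrict_cong)
  also have "\<dots> = (\<integral>\<^sup>+U. g U \<partial>distr Q ?L (\<lambda>w. \<lambda>n\<in>{..<N}. step (X n w)))"
    using g Xm by (simp add: nn_integral_distr)
  also have "\<dots> = (\<integral>\<^sup>+w. g (\<lambda>n\<in>{..<N}. u n w) \<partial>P)"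
    using g um by (simp add: iid_path_law[OF u X, symmetric] nn_integral_distr)
  finally have "ennreal (1 / ?M) * matrix_risk Q N X (\<lambda>x. cell_matrix (k (\<lambda>n\<in>{..<N}. step (x n)))) S
      = (\<integral>\<^sup>+w. ennreal (1 / ?M) * g (\<lambda>n\<in>{..<N}. u n w) \<partial>P)"
    using measurable_compose[OF um g] by (simp add: nn_integral_cmult)
  \<comment> \<open>Only \<open>g\<close>, shown measurable above, moves between the probability
    spaces; the operator error is compared with it pointwise on \<open>P\<close>.\<close>
  also have "\<dots> \<le> operator_risk P N u Chat (block_operator I S)"
    unfolding operator_risk_def
  proof (rule nn_integral_mono)
    fix w assume "w \<in> space P"
    then have U: "(\<lambda>n\<in>{..<N}. u n w) \<in> space ?L" by (rule measurable_space[OF um])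
    show "ennreal (1 / ?M) * g (\<lambda>n\<in>{..<N}. u n w)
        \<le> ennreal (onorm (\<lambda>\<psi>. Chat (\<lambda>n\<in>{..<N}. u n w) \<psi> - block_operator I S \<psi>))"
      using cell_matrix_error[OF L2[OF U], of S]
      by (simp add: g_def Chat[OF U] ennreal_mult''[symmetric] ennreal_leI onorm_pos_le)
  qed
  finally show ?thesis .
qed

lemma cell_matrix_estimator:
  assumes "(\<lambda>(u, x, y). k u x y) \<in> borel_measurable
      ((\<Pi>\<^sub>M n\<in>{..<N}. path_space) \<Otimes>\<^sub>M (cube_measure \<Otimes>\<^sub>M cube_measure))"
  shows "(\<lambda>x. cell_matrix (k (\<lambda>n\<in>{..<N}. step (x n)))) \<in> matrix_estimators N"
  unfolding matrix_estimators_def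
proof (rule measurable_compose[OF _ measurable_cell_matrix[OF assms]])
  show "(\<lambda>x. \<lambda>n\<in>{..<N}. step (x n)) \<in> (\<Pi>\<^sub>M n\<in>{..<N}. borel) \<rightarrow>\<^sub>M (\<Pi>\<^sub>M n\<in>{..<N}. path_space)"
  proof (rule measurable_restrict)
    fix n assume "n \<in> {..<N}"
    then have "(\<lambda>x. x n) \<in> (\<Pi>\<^sub>M n\<in>{..<N}. borel) \<rightarrow>\<^sub>M (borel :: (real^'m) measure)"
      by (rule measurable_component_singleton)
    then show "(\<lambda>x. step (x n)) \<in> (\<Pi>\<^sub>M n\<in>{..<N}. borel) \<rightarrow>\<^sub>M path_space"
      by (rule measurable_compose[OF _ measurable_step])
  qed
qed

end

section \<open>Minimax bounds\<close>

text \<open>Here \<open>s\<close> stands for the matrix norm and \<open>s / M\<close> for the norm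
  of its block operator: the factor 1/M between the risks cancels against the one between the
  norms.\<close>

lemma relative_risk_mono:
  fixes a b :: ennreal and s M :: real
  assumes "ennreal (1 / M) * a \<le> b" "s > 0" "M > 0"
  shows "a / ennreal s \<le> b / ennreal (s / M)"
proof -
  have "a / ennreal s = a * (ennreal (1 / M) * ennreal (M / s))"
    using assms by (simp add: divide_ennreal_def inverse_ennreal ennreal_mult[symmetric] inverse_eq_divide)
  also have "\<dots> = (ennreal (1 / M) * a) * ennreal (M / s)"
    by (simp add: mult_ac)
  also have "\<dots> \<le> b * ennreal (M / s)"
    using assms(1) by (rule mult_right_mono) simp
  also have "\<dots> = b / ennreal (s / M)"
    using assms by (simp add: divide_ennreal_def inverse_ennreal)
  finally show ?thesis .
qed

theorem proposition2p9:
  fixes I :: "'m::finite \<Rightarrow> (real^'d) set"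
    and F :: "(real^'m^'m) set"
  assumes "uniform_partition I"
    and "\<forall>S\<in>F. psd_matrix S"
  shows "(\<forall>S\<in>F. L2_kernel (block_kernel I S) \<and>
            psd_operator (block_operator I S) \<and> trace_class (block_operator I S)) \<and>
    (\<forall>S\<in>F. onorm (block_operator I S) = 1 / real CARD('m) * onorm ((*v) S)) \<and>
    (\<forall>(N::nat)
        (P :: ('d L2 \<Rightarrow> 'd L2) \<Rightarrow> 'w measure)
        (u :: ('d L2 \<Rightarrow> 'd L2) \<Rightarrow> nat \<Rightarrow> 'w \<Rightarrow> real^'d \<Rightarrow> real)
        (Q :: real^'m^'m \<Rightarrow> 'v measure)
        (X :: real^'m^'m \<Rightarrow> nat \<Rightarrow> 'v \<Rightarrow> real^'m).
       (\<forall>S\<in>F. iid_gaussian_processes (P (block_operator I S)) N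
                  (block_kernel I S) (u (block_operator I S))) \<and>
       (\<forall>S\<in>F. iid_gaussian_vectors (Q S) N S (X S)) \<longrightarrow>
       (let Fstar = block_operator I ` F in
         (INF Chat\<in>operator_estimators N. SUP C\<in>Fstar. operator_risk (P C) N (u C) Chat C)
           \<ge> ennreal (1 / real CARD('m)) *
             (INF Shat\<in>matrix_estimators N. SUP S\<in>F. matrix_risk (Q S) N (X S) Shat S) \<and>
         (INF Chat\<in>operator_estimators N. SUP C\<in>Fstar - {\<lambda>_. 0}.
             operator_risk (P C) N (u C) Chat C / ennreal (onorm C))
           \<ge> (INF Shat\<in>matrix_estimators N. SUP S\<in>F - {0}.
                 matrix_risk (Q S) N (X S) Shat S / ennreal (onorm ((*v) S)))))"
proof -
  interpret cube_partition I by unfold_locales fact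
  let ?M = "real CARD('m)"
  show ?thesis
    unfolding Let_def
  proof (intro conjI ballI allI impI)
    fix S assume "S \<in> F"
    then have "psd_matrix S" using assms(2) by blast
    then show "psd_operator (block_operator I S)" "trace_class (block_operator I S)"
      by (rule psd_block_operator trace_class_block_operator)+
    show "L2_kernel (block_kernel I S)"
      by (rule L2_kernel_block_kernel)
    show "onorm (block_operator I S) = 1 / ?M * onorm ((*v) S)"
      by (simp add: onorm_block_operator)
  next
    fix N :: nat and P :: "('d L2 \<Rightarrow> 'd L2) \<Rightarrow> 'w measure"
      and u :: "('d L2 \<Rightarrow> 'd L2) \<Rightarrow> nat \<Rightarrow> 'w \<Rightarrow> real^'d \<Rightarrow> real"
      and Q :: "real^'m^'m \<Rightarrow> 'v measure" and X :: "real^'m^'m \<Rightarrow> nat \<Rightarrow> 'v \<Rightarrow> real^'m"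
    assume data: "(\<forall>S\<in>F. iid_gaussian_processes (P (block_operator I S)) N
                  (block_kernel I S) (u (block_operator I S))) \<and>
       (\<forall>S\<in>F. iid_gaussian_vectors (Q S) N S (X S))"
    \<comment> \<open>The quantifier order is the point: the matrix estimator is built from the
      kernel of \<open>Chat\<close> alone, so one choice serves all \<open>S\<close> and the
      inequality survives the supremum.\<close>
    have transfer: "\<exists>Shat\<in>matrix_estimators N. \<forall>S\<in>F.
        ennreal (1 / ?M) * matrix_risk (Q S) N (X S) Shat S \<le>
        operator_risk (P (block_operator I S)) N (u (block_operator I S)) Chat (block_operator I S)"
      if "Chat \<in> operator_estimators N" for Chat
    proof -
      from that have "\<exists>k. (\<lambda>(u, x, y). k u x y) \<in> borel_measurable
          ((\<Pi>\<^sub>M n\<in>{..<N}. path_space) \<Otimes>\<^sub>M (cube_measure \<Otimes>\<^sub>M cube_measure)) \<and>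
          (\<forall>u\<in>space (\<Pi>\<^sub>M n\<in>{..<N}. path_space).
            L2_kernel (k u) \<and> Chat u = integral_operator (k u))"
        unfolding operator_estimators_def by (rule CollectD)
      then obtain k where k: "(\<lambda>(u, x, y). k u x y) \<in> borel_measurable
          ((\<Pi>\<^sub>M n\<in>{..<N}. path_space) \<Otimes>\<^sub>M (cube_measure \<Otimes>\<^sub>M cube_measure))"
        and Chat: "\<forall>u\<in>space (\<Pi>\<^sub>M n\<in>{..<N}. path_space).
          L2_kernel (k u) \<and> Chat u = integral_operator (k u)"
        by (elim exE conjE)
      show ?thesis
      proof (intro bexI ballI)
        fix S assume "S \<in> F"
        then show "ennreal (1 / ?M) *
            matrix_risk (Q S) N (X S) (\<lambda>x. cell_matrix (k (\<lambda>n\<in>{..<N}. step (x n)))) S \<le>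
            operator_risk (P (block_operator I S)) N (u (block_operator I S)) Chat (block_operator I S)"
          using data Chat by (intro matrix_risk_le_operator_risk[OF k]) simp_all
      qed (rule cell_matrix_estimator[OF k])
    qed
    show "(INF Chat\<in>operator_estimators N. SUP C\<in>block_operator I ` F. operator_risk (P C) N (u C) Chat C)
        \<ge> ennreal (1 / ?M) * (INF Shat\<in>matrix_estimators N. SUP S\<in>F. matrix_risk (Q S) N (X S) Shat S)"
    proof (rule INF_greatest)
      fix Chat :: "(nat \<Rightarrow> real^'d \<Rightarrow> real) \<Rightarrow> 'd L2 \<Rightarrow> 'd L2"
      assume "Chat \<in> operator_estimators N"
      from transfer[OF this] obtain Shat where Shat: "Shat \<in> matrix_estimators N"
        and le: "\<And>S. S \<in> F \<Longrightarrow> ennreal (1 / ?M) * matrix_risk (Q S) N (X S) Shat S \<le>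
          operator_risk (P (block_operator I S)) N (u (block_operator I S)) Chat (block_operator I S)"
        by blast
      have "ennreal (1 / ?M) * (INF Shat\<in>matrix_estimators N. SUP S\<in>F. matrix_risk (Q S) N (X S) Shat S)
          \<le> ennreal (1 / ?M) * (SUP S\<in>F. matrix_risk (Q S) N (X S) Shat S)"
        by (intro mult_left_mono INF_lower Shat) simp
      also have "\<dots> = (SUP S\<in>F. ennreal (1 / ?M) * matrix_risk (Q S) N (X S) Shat S)"
        by (rule SUP_mult_left_ennreal)
      also have "\<dots> \<le> (SUP C\<in>block_operator I ` F. operator_risk (P C) N (u C) Chat C)"
        by (rule SUP_least, rule order_trans[OF le], assumption, rule SUP_upper, rule imageI)
      finally show "ennreal (1 / ?M) *
          (INF Shat\<in>matrix_estimators N. SUP S\<in>F. matrix_risk (Q S) N (X S) Shat S)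
          \<le> (SUP C\<in>block_operator I ` F. operator_risk (P C) N (u C) Chat C)" .
    qed
    show "(INF Chat\<in>operator_estimators N. SUP C\<in>block_operator I ` F - {\<lambda>_. 0}.
             operator_risk (P C) N (u C) Chat C / ennreal (onorm C))
        \<ge> (INF Shat\<in>matrix_estimators N. SUP S\<in>F - {0}.
             matrix_risk (Q S) N (X S) Shat S / ennreal (onorm ((*v) S)))"
    proof (rule INF_greatest)
      fix Chat :: "(nat \<Rightarrow> real^'d \<Rightarrow> real) \<Rightarrow> 'd L2 \<Rightarrow> 'd L2"
      assume "Chat \<in> operator_estimators N"
      from transfer[OF this] obtain Shat where Shat: "Shat \<in> matrix_estimators N"
        and le: "\<And>S. S \<in> F \<Longrightarrow> ennreal (1 / ?M) * matrix_risk (Q S) N (X S) Shat S \<le>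
          operator_risk (P (block_operator I S)) N (u (block_operator I S)) Chat (block_operator I S)"
        by blast
      have "(INF Shat\<in>matrix_estimators N. SUP S\<in>F - {0}.
             matrix_risk (Q S) N (X S) Shat S / ennreal (onorm ((*v) S)))
          \<le> (SUP S\<in>F - {0}. matrix_risk (Q S) N (X S) Shat S / ennreal (onorm ((*v) S)))"
        by (rule INF_lower[OF Shat])
      also have "\<dots> \<le> (SUP C\<in>block_operator I ` F - {\<lambda>_. 0}.
             operator_risk (P C) N (u C) Chat C / ennreal (onorm C))"
      proof (rule SUP_least)
        fix S assume S: "S \<in> F - {0}"
        \<comment> \<open>By the norm formula a nonzero matrix has a nonzero block operator, so
          \<open>S\<close> still has a counterpart after the zero operator is removed.\<close>
        then have "\<exists>v. S *v v \<noteq> 0" by (metis DiffD2 matrix_eq matrix_vector_mult_0 singletonI)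
        then have pos: "onorm ((*v) S) > 0"
          by (simp add: onorm_pos_lt matrix_vector_mul_bounded_linear)
        then have "onorm (block_operator I S) > 0"
          by (simp add: onorm_block_operator)
        then have "block_operator I S \<noteq> (\<lambda>_. 0)"
          by (auto simp: onorm_zero)
        then have "block_operator I S \<in> block_operator I ` F - {\<lambda>_. 0}"
          using S by blast
        moreover have "matrix_risk (Q S) N (X S) Shat S / ennreal (onorm ((*v) S)) \<le>
            operator_risk (P (block_operator I S)) N (u (block_operator I S)) Chat (block_operator I S)
              / ennreal (onorm (block_operator I S))"
          unfolding onorm_block_operator using le[of S] S pos by (intro relative_risk_mono) auto
        ultimately show "matrix_risk (Q S) N (X S) Shat S / ennreal (onorm ((*v) S)) \<le>
            (SUP C\<in>block_operator I ` F - {\<lambda>_. 0}.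
             operator_risk (P C) N (u C) Chat C / ennreal (onorm C))"
          by (rule SUP_upper2[where i = "block_operator I S"
              and f = "\<lambda>C. operator_risk (P C) N (u C) Chat C / ennreal (onorm C)"])
      qed
      finally show "(INF Shat\<in>matrix_estimators N. SUP S\<in>F - {0}.
             matrix_risk (Q S) N (X S) Shat S / ennreal (onorm ((*v) S)))
          \<le> (SUP C\<in>block_operator I ` F - {\<lambda>_. 0}.
             operator_risk (P C) N (u C) Chat C / ennreal (onorm C))" .
    qed
  qed
qed

end
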